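(* Let $K$ be a field, $S=K[t_1,t_2,t_3]$ and let $I$ be a homogeneous lattice ideal of $S$ of height $2$. Then $I$ is generated by a full set of critical binomials. Concretely, and with a suitable renumbering of the variables, only the two following cases can occur (all exponents being non-negative integers): (a) $I$ is minimally generated by $f_1=t_1^{a_1}-t_3^{c_3}$ and $f_2=t_2^{b_2}-t_1^{b_1}t_3^{b_3}$, with $0\leq b_1\leq a_1$, $a_1,b_2,c_3>0$ and $b_1+b_3>0$; (b) $I$ is minimally generated by $f_1=t_1^{a_1}-t_2^{a_2}t_3^{a_3}$, $f_2=t_2^{b_2}-t_1^{b_1}t_3^{b_3}$ and $f_3=t_3^{c_3}-t_1^{c_1}t_2^{c_2}$, with $0<a_2<b_2$, $0<a_3<c_3$, $0<b_1<a_1$, $0<b_3<c_3$, $0<c_1<a_1$ and $0<c_2<b_2$. Moreover, $a_1=b_1+c_1$, $b_2=a_2+c_2$ and $c_3=a_3+b_3$.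
   Context: For $a\in\mathbb{Z}^s$ write $a=a^+-a^-$ with $a^\pm\in\mathbb{N}^s$ of disjoint support; a lattice ideal is an ideal of the form $I(\mathcal{L})=(t^{a^+}-t^{a^-}\mid a\in\mathcal{L})$ for a subgroup (lattice) $\mathcal{L}\subset\mathbb{Z}^s$, here $s=3$. Homogeneous means homogeneous with respect to some grading of $S$ with $\deg t_i=d_i$ a positive integer. Let $I$ be a binomial ideal (generated by differences of monomials) and $f=t^a-t^b\in I$. $f$ is $t_i$-pure if $t^a$ and $t^b$ are non-constant, have no common variables, and $t^a$ is a power of $t_i$ (i.e. ${\rm supp}(a)=\{i\}$). $f$ is $t_i$-critical if $f$ is $t_i$-pure and for any other $t_i$-pure binomial $g=t_i^{c_i}-t^d$ of $I$ one has $c_i\geq a_i$. A full set of critical binomials of $I$ is a family $f_1,\ldots,f_s$ of binomials where each $f_i$ is a $t_i$-critical binomial of $I$ (possibly $f_j=-f_i$ for some $i\ne j$). *)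

theory Defs
  imports
    "HOL-Algebra.Ideal"
    "HOL-Algebra.Free_Abelian_Groups"
    "HOL-Algebra.Algebraic_Closure_Type"
    "HOL-Library.Poly_Mapping"
    "HOL-Library.Numeral_Type"
    "HOL-Library.Extended_Nat"
begin

text \<open>For a finite type \<open>'v\<close> of variables, \<open>'v \<Rightarrow>\<^sub>0 nat\<close> is the monoid of exponent vectors and
  finitely supported functions on it, with the convolution product, form the polynomial ring.
  For three variables we take the numeral type \<open>3\<close>, whose elements are \<open>1\<close>, \<open>2\<close> and \<open>3 = 0\<close>.\<close>

type_synonym ('v, 'k) mpol = "('v \<Rightarrow>\<^sub>0 nat) \<Rightarrow>\<^sub>0 'k"

abbreviation mpol_ring :: "('v, 'k :: comm_ring_1) mpol ring" where
  "mpol_ring \<equiv> ring_of_type_algebra"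

definition mon :: "('v \<Rightarrow>\<^sub>0 nat) \<Rightarrow> ('v, 'k :: comm_ring_1) mpol" where
  "mon a = Poly_Mapping.single a 1"

definition indet :: "'v \<Rightarrow> ('v, 'k :: comm_ring_1) mpol" where
  "indet i = mon (Poly_Mapping.single i 1)"

definition prime_height :: "('r, 'm) ring_scheme \<Rightarrow> 'r set \<Rightarrow> enat" where
  "prime_height R P = Sup {enat n | n C.
     (\<forall>i\<le>n. primeideal (C i) R) \<and> (\<forall>i<n. C i \<subset> C (Suc i)) \<and> C n = P}"

text \<open>The unit ideal lies in no prime and gets height \<open>Inf {} = \<infinity>\<close>.\<close>

definition height :: "('r, 'm) ring_scheme \<Rightarrow> 'r set \<Rightarrow> enat" where
  "height R I = Inf {prime_height R P | P. primeideal P R \<and> I \<subseteq> P}"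

definition wdeg :: "('v :: finite \<Rightarrow> nat) \<Rightarrow> ('v \<Rightarrow>\<^sub>0 nat) \<Rightarrow> nat" where
  "wdeg d a = (\<Sum>i\<in>UNIV. d i * Poly_Mapping.lookup a i)"

definition hom_component ::
    "('v :: finite \<Rightarrow> nat) \<Rightarrow> nat \<Rightarrow> ('v, 'k :: comm_ring_1) mpol \<Rightarrow> ('v, 'k) mpol" where
  "hom_component d n f =
     (\<Sum>a \<in> {a \<in> Poly_Mapping.keys f. wdeg d a = n}. Poly_Mapping.single a (Poly_Mapping.lookup f a))"

text \<open>\<open>d i\<close> is the degree of the variable \<open>i\<close>.\<close>

definition homogeneous_wrt :: "('v :: finite \<Rightarrow> nat) \<Rightarrow> ('v, 'k :: comm_ring_1) mpol set \<Rightarrow> bool" where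
  "homogeneous_wrt d I \<longleftrightarrow> (\<forall>f\<in>I. \<forall>n. hom_component d n f \<in> I)"

definition homogeneous_ideal :: "('v :: finite, 'k :: comm_ring_1) mpol set \<Rightarrow> bool" where
  "homogeneous_ideal I \<longleftrightarrow> ideal I mpol_ring \<and> (\<exists>d. (\<forall>i. 0 < d i) \<and> homogeneous_wrt d I)"

text \<open>The conversion \<open>nat\<close> sends negative integers to \<open>0\<close>, so these are the two vectors of
  disjoint support with difference \<open>a\<close>.\<close>

definition pos_part :: "('v \<Rightarrow>\<^sub>0 int) \<Rightarrow> 'v \<Rightarrow>\<^sub>0 nat" where
  "pos_part a = Poly_Mapping.map nat a"

definition neg_part :: "('v \<Rightarrow>\<^sub>0 int) \<Rightarrow> 'v \<Rightarrow>\<^sub>0 nat" where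
  "neg_part a = Poly_Mapping.map nat (- a)"

text \<open>For finite \<open>'v\<close>, \<open>free_Abelian_group UNIV\<close> is the group of all integer vectors indexed
  by \<open>'v\<close>.\<close>

definition lattice_ideal :: "('v :: finite, 'k :: comm_ring_1) mpol set \<Rightarrow> bool" where
  "lattice_ideal I \<longleftrightarrow>
     (\<exists>L. subgroup L (free_Abelian_group UNIV) \<and>
          I = genideal mpol_ring {mon (pos_part a) - mon (neg_part a) | a. a \<in> L})"

text \<open>\<open>pure_exponents i a b\<close> says that \<open>mon a - mon b\<close>, written with these exponents, is
  \<open>indet i\<close>-pure. The exponents are kept because in characteristic 2 a binomial does not determine
  which of its two terms comes first.\<close>

definition pure_exponents :: "'v \<Rightarrow> ('v \<Rightarrow>\<^sub>0 nat) \<Rightarrow> ('v \<Rightarrow>\<^sub>0 nat) \<Rightarrow> bool" where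
  "pure_exponents i a b \<longleftrightarrow> a \<noteq> 0 \<and> b \<noteq> 0 \<and>
     Poly_Mapping.keys a \<inter> Poly_Mapping.keys b = {} \<and> Poly_Mapping.keys a = {i}"

definition critical :: "('v, 'k :: comm_ring_1) mpol set \<Rightarrow> 'v \<Rightarrow> ('v, 'k) mpol \<Rightarrow> bool" where
  "critical I i f \<longleftrightarrow> f \<in> I \<and>
     (\<exists>a b. f = mon a - mon b \<and> pure_exponents i a b \<and>
        (\<forall>c d. pure_exponents i c d \<and> mon c - mon d \<in> I \<longrightarrow>
           Poly_Mapping.lookup a i \<le> Poly_Mapping.lookup c i))"

definition full_set_of_critical_binomials ::
    "('v, 'k :: comm_ring_1) mpol set \<Rightarrow> ('v \<Rightarrow> ('v, 'k) mpol) \<Rightarrow> bool" where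
  "full_set_of_critical_binomials I f \<longleftrightarrow> (\<forall>i. critical I i (f i))"

definition minimally_generated ::
    "('r, 'm) ring_scheme \<Rightarrow> 'r set \<Rightarrow> 'r set \<Rightarrow> bool" where
  "minimally_generated R I G \<longleftrightarrow> genideal R G = I \<and> (\<forall>H. H \<subset> G \<longrightarrow> genideal R H \<noteq> I)"

end

theory Submission
  imports Defs
begin

text \<open>A lattice ideal consists of the polynomials that are killed by all linear functionals constant
  on the classes of exponent vectors modulo \<open>L\<close>, so \<open>t\<^sup>a - t\<^sup>b\<close> lies in it exactly when \<open>a - b \<in> L\<close>.
  Homogeneity puts \<open>L\<close> into the orthogonal complement of the positive vector \<open>d\<close>. If \<open>L\<close> had rank at
  most one, its ideal would be contained in the prime ideal of a saturated rank one lattice, which is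
  principal and therefore of height at most one; so \<open>L\<close> has rank two and contains, for each \<open>i\<close>, a
  vector whose only positive coordinate is the \<open>i\<close>-th.

  Choose such vectors with minimal positive coordinate. If all their other coordinates are negative,
  minimality forces the three vectors to add up to zero, and a binomial is rewritten with the critical
  ones until its two monomials share a variable, which is then cancelled. Otherwise minimality
  produces critical vectors \<open>\<delta>\<close> and \<open>- \<delta>\<close> for two of the variables, and \<open>\<delta>\<close> and a critical vector of
  the third variable form a basis of \<open>L\<close>.\<close>

subsection \<open>Ideals in commutative rings\<close>

abbreviation gideal :: "'a :: comm_ring_1 set \<Rightarrow> 'a set" where
  "gideal S \<equiv> genideal ring_of_type_algebra S"

lemma ideal_type_iff:
  "ideal I (ring_of_type_algebra :: 'a :: comm_ring_1 ring) \<longleftrightarrow>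
     0 \<in> I \<and> (\<forall>x\<in>I. \<forall>y\<in>I. x + y \<in> I) \<and> (\<forall>x\<in>I. \<forall>y. y * x \<in> I)"
  (is "?l \<longleftrightarrow> ?r")
proof
  assume ?l
  then interpret ideal I "ring_of_type_algebra :: 'a ring" .
  show ?r
    using additive_subgroup.a_closed[OF is_additive_subgroup]
      additive_subgroup.zero_closed[OF is_additive_subgroup] I_l_closed
    by (auto simp: ring_of_type_algebra_def)
next
  assume r: ?r
  have inv: "inv\<^bsub>add_monoid (ring_of_type_algebra :: 'a ring)\<^esub> x = - x" for x :: 'a
  proof -
    interpret R: ring "ring_of_type_algebra :: 'a ring"
      by (rule ring_from_type_algebra)
    have "\<ominus>\<^bsub>ring_of_type_algebra\<^esub> x = - x"
      by (rule R.minus_equality) (auto simp: ring_of_type_algebra_def)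
    then show ?thesis
      by (simp add: a_inv_def)
  qed
  have "- x \<in> I" if "x \<in> I" for x
    using r that by (metis mult_minus1)
  then show ?l
    using r inv
    by (intro idealI ring_from_type_algebra subgroup.intro)
       (auto simp: ring_of_type_algebra_def mult.commute)
qed

lemma primeideal_type_iff:
  "primeideal P (ring_of_type_algebra :: 'a :: comm_ring_1 ring) \<longleftrightarrow>
     ideal P (ring_of_type_algebra :: 'a ring) \<and> P \<noteq> UNIV \<and>
     (\<forall>x y. x * y \<in> P \<longrightarrow> x \<in> P \<or> y \<in> P)"
  (is "?l \<longleftrightarrow> ?r")
proof
  assume ?l
  then interpret primeideal P "ring_of_type_algebra :: 'a ring" .
  show ?r
    using is_ideal I_notcarr I_prime by (auto simp: ring_of_type_algebra_def)
next
  assume ?r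
  then show ?l
    by (intro primeidealI cring_from_type_algebra) (auto simp: ring_of_type_algebra_def)
qed

lemma ideal_gideal: "ideal (gideal S) (ring_of_type_algebra :: 'a :: comm_ring_1 ring)"
  by (rule ring.genideal_ideal[OF ring_from_type_algebra]) (simp add: ring_of_type_algebra_def)

lemma gideal_base: "x \<in> S \<Longrightarrow> x \<in> gideal S"
  by (auto simp: genideal_def)

lemma gideal_zero: "0 \<in> gideal S"
  and gideal_add: "x \<in> gideal S \<Longrightarrow> y \<in> gideal S \<Longrightarrow> x + y \<in> gideal S"
  and gideal_mult: "x \<in> gideal S \<Longrightarrow> z * x \<in> gideal S"
  using ideal_gideal[of S] by (auto simp: ideal_type_iff)

lemma gideal_uminus: "x \<in> gideal S \<Longrightarrow> - x \<in> gideal S"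
  using gideal_mult[of x S "- 1"] by simp

lemma gideal_subset:
  "ideal I (ring_of_type_algebra :: 'a :: comm_ring_1 ring) \<Longrightarrow> S \<subseteq> I \<Longrightarrow> gideal S \<subseteq> I"
  by (auto simp: genideal_def)

lemma gideal_subset_gideal: "S \<subseteq> gideal T \<Longrightarrow> gideal S \<subseteq> gideal T"
  by (rule gideal_subset[OF ideal_gideal])

lemma in_gideal_singleton:
  fixes p :: "'a :: comm_ring_1"
  assumes "f \<in> gideal {p}"
  obtains r where "f = r * p"
proof -
  have "ideal {f. \<exists>r. f = r * p} (ring_of_type_algebra :: 'a ring)"
    unfolding ideal_type_iff by (auto intro: exI[of _ 0] simp flip: mult.assoc distrib_right)
  moreover have "p \<in> {f. \<exists>r. f = r * p}"
    by (auto intro: exI[of _ 1])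
  ultimately have "gideal {p} \<subseteq> {f. \<exists>r. f = r * p}"
    by (intro gideal_subset) auto
  with assms that show thesis
    by auto
qed

text \<open>A chain of primes of length at least two ending in \<open>P\<close> has two strictly
  nested members strictly below \<open>P\<close>, which the assumption \<open>Q\<close>
  excludes.\<close>

lemma height_less_two:
  assumes P: "primeideal P R" "I \<subseteq> P"
    and Q: "\<And>Q Q'. primeideal Q R \<Longrightarrow> primeideal Q' R \<Longrightarrow> Q' \<subset> Q \<Longrightarrow> \<not> Q \<subset> P"
  shows "height R I < 2"
proof -
  have "height R I \<le> prime_height R P"
    unfolding height_def using P by (intro Inf_lower) auto
  also have "prime_height R P \<le> 1"
    unfolding prime_height_def
  proof (intro Sup_least, clarify)
    fix n :: nat and C
    assume C: "\<forall>i\<le>n. primeideal (C i) R" "\<forall>i<n. C i \<subset> C (Suc i)" "P = C n"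
    have "n \<le> 1"
    proof (rule ccontr)
      assume "\<not> n \<le> 1"
      then obtain m where n: "n = Suc (Suc m)"
        by (metis One_nat_def le_SucI le_zero_eq not0_implies_Suc not_less_eq_eq nle_le)
      show False
        using Q[of "C (Suc m)" "C m"] C unfolding n by auto
    qed
    then show "enat n \<le> 1"
      by (simp add: one_enat_def)
  qed
  also have "(1 :: enat) < 2"
    by (simp add: one_enat_def numeral_eq_enat)
  finally show ?thesis .
qed

subsection \<open>Linear functionals and binomial ideals\<close>

lemma sum_singles: "(\<Sum>a\<in>Poly_Mapping.keys f. Poly_Mapping.single a (Poly_Mapping.lookup f a)) = f"
proof (rule poly_mapping_eqI)
  fix b
  show "Poly_Mapping.lookup (\<Sum>a\<in>Poly_Mapping.keys f. Poly_Mapping.single a (Poly_Mapping.lookup f a)) b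
      = Poly_Mapping.lookup f b"
    by (cases "b \<in> Poly_Mapping.keys f")
       (auto simp: lookup_sum lookup_single when_def sum.delta in_keys_iff)
qed

text \<open>The new term is not tied to the support of \<open>f\<close>, so identities between
  additive maps reduce to single terms.\<close>

lemma poly_mapping_single_induct [case_names zero add]:
  fixes f :: "'a \<Rightarrow>\<^sub>0 'b :: comm_monoid_add"
  assumes "P 0" "\<And>a c f. P f \<Longrightarrow> P (Poly_Mapping.single a c + f)"
  shows "P f"
proof -
  have "P (\<Sum>a\<in>A. Poly_Mapping.single a (Poly_Mapping.lookup f a))" if "finite A" for A
    using that by (induction A) (auto simp: assms)
  from this[OF finite_keys, of f] show ?thesis
    by (simp add: sum_singles)
qed

lemma ideal_mpolI:
  fixes I :: "('v, 'k :: comm_ring_1) mpol set"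
  assumes "0 \<in> I" "\<And>f g. f \<in> I \<Longrightarrow> g \<in> I \<Longrightarrow> f + g \<in> I"
    and "\<And>f c k. f \<in> I \<Longrightarrow> Poly_Mapping.single c k * f \<in> I"
  shows "ideal I mpol_ring"
proof -
  have "g * f \<in> I" if "f \<in> I" for f g
    by (induction g rule: poly_mapping_single_induct) (auto simp: assms that distrib_right)
  then show ?thesis
    using assms by (auto simp: ideal_type_iff)
qed

section \<open>Additive maps on polynomials defined term by term\<close>

text \<open>Common shape of the linear functionals, of the change of exponents \<open>push\<close>
  and of the homogeneous components.\<close>

definition key_sum :: "('a \<Rightarrow> 'b \<Rightarrow> 'c) \<Rightarrow> ('a \<Rightarrow>\<^sub>0 'b :: zero) \<Rightarrow> 'c :: comm_monoid_add" where
  "key_sum h f = (\<Sum>a\<in>Poly_Mapping.keys f. h a (Poly_Mapping.lookup f a))"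

lemma key_sum_superset:
  assumes "\<And>a. h a 0 = 0" "finite A" "Poly_Mapping.keys f \<subseteq> A"
  shows "key_sum h f = (\<Sum>a\<in>A. h a (Poly_Mapping.lookup f a))"
  unfolding key_sum_def using assms
  by (intro sum.mono_neutral_left) (auto simp: in_keys_iff)

lemma key_sum_zero [simp]: "key_sum h 0 = 0"
  by (simp add: key_sum_def)

lemma key_sum_single: "h a 0 = 0 \<Longrightarrow> key_sum h (Poly_Mapping.single a c) = h a c"
  by (simp add: key_sum_def)

lemma key_sum_add:
  assumes h: "\<And>a. h a 0 = 0" "\<And>a x y. h a (x + y) = h a x + h a y"
  shows "key_sum h (f + g) = key_sum h f + key_sum h g"
proof -
  let ?A = "Poly_Mapping.keys f \<union> Poly_Mapping.keys g"
  have "Poly_Mapping.keys (f + g) \<subseteq> ?A"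
    by (rule keys_add)
  then show ?thesis
    using h by (simp add: key_sum_superset[of _ ?A] lookup_add sum.distrib)
qed

lemma key_sum_diff:
  fixes h :: "'a \<Rightarrow> 'b :: ab_group_add \<Rightarrow> 'c :: ab_group_add"
  assumes h: "\<And>a. h a 0 = 0" "\<And>a x y. h a (x + y) = h a x + h a y"
  shows "key_sum h (f - g) = key_sum h f - key_sum h g"
  using key_sum_add[of h "f - g" g] h by (simp add: algebra_simps)

definition functional :: "('a \<Rightarrow> 'k) \<Rightarrow> ('a \<Rightarrow>\<^sub>0 'k) \<Rightarrow> 'k :: comm_ring_1" where
  "functional \<psi> = key_sum (\<lambda>a c. c * \<psi> a)"

lemma functional_zero [simp]: "functional \<psi> 0 = 0"
  and functional_add: "functional \<psi> (f + g) = functional \<psi> f + functional \<psi> g"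
  and functional_diff: "functional \<psi> (f - g) = functional \<psi> f - functional \<psi> g"
  and functional_single [simp]: "functional \<psi> (Poly_Mapping.single a c) = c * \<psi> a"
  by (simp_all add: functional_def key_sum_add key_sum_diff key_sum_single distrib_right)

lemma functional_single_mult:
  "functional \<psi> (Poly_Mapping.single c k * f) = k * functional (\<lambda>a. \<psi> (c + a)) f"
  by (induction f rule: poly_mapping_single_induct)
     (auto simp: distrib_left functional_add mult_single mult.assoc)

text \<open>The map of monoid algebras induced by a map \<open>g\<close> of exponents, compatible
  with products when \<open>g\<close> is additive.\<close>

definition push :: "('a \<Rightarrow> 'b) \<Rightarrow> ('a \<Rightarrow>\<^sub>0 'k) \<Rightarrow> 'b \<Rightarrow>\<^sub>0 'k :: comm_ring_1" where
  "push g = key_sum (\<lambda>a. Poly_Mapping.single (g a))"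

lemma push_zero [simp]: "push g 0 = 0"
  and push_add: "push g (f + f') = push g f + push g f'"
  and push_diff: "push g (f - f') = push g f - push g f'"
  and push_single [simp]: "push g (Poly_Mapping.single a c) = Poly_Mapping.single (g a) c"
  by (simp_all add: push_def key_sum_add key_sum_diff key_sum_single single_add)

lemma push_mult:
  assumes "\<And>a b. g (a + b) = g a + g b"
  shows "push g (f * f') = push g f * push g f'"
proof -
  have "push g (Poly_Mapping.single a c * f') = Poly_Mapping.single (g a) c * push g f'" for a c
    by (induction f' rule: poly_mapping_single_induct)
       (auto simp: distrib_left push_add mult_single assms)
  then show ?thesis
    by (induction f rule: poly_mapping_single_induct) (auto simp: distrib_right push_add)
qed

lemma functional_push: "functional \<chi> (push g f) = functional (\<lambda>a. \<chi> (g a)) f"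
  by (induction f rule: poly_mapping_single_induct) (auto simp: push_add functional_add)

section \<open>Polynomials killed by invariant functionals\<close>

text \<open>For an equivalence relation \<open>r\<close> this says that the coefficients of
  \<open>f\<close> over each class add up to zero.\<close>

definition annihilator ::
    "(('v \<Rightarrow>\<^sub>0 nat) \<Rightarrow> ('v \<Rightarrow>\<^sub>0 nat) \<Rightarrow> bool) \<Rightarrow> ('v, 'k :: comm_ring_1) mpol set" where
  "annihilator r = {f. \<forall>\<psi>. (\<forall>a b. r a b \<longrightarrow> \<psi> a = \<psi> b) \<longrightarrow> functional \<psi> f = 0}"

lemma annihilatorD: "f \<in> annihilator r \<Longrightarrow> (\<And>a b. r a b \<Longrightarrow> \<psi> a = \<psi> b) \<Longrightarrow> functional \<psi> f = 0"
  by (auto simp: annihilator_def)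

text \<open>Translating an invariant weight by \<open>c\<close> leaves it invariant, and
  multiplication by a term of exponent \<open>c\<close> is dual to this translation.\<close>

lemma ideal_annihilator:
  assumes "\<And>a b c. r a b \<Longrightarrow> r (c + a) (c + b)"
  shows "ideal (annihilator r :: ('v, 'k :: comm_ring_1) mpol set) mpol_ring"
proof (rule ideal_mpolI)
  fix f :: "('v, 'k) mpol" and c k
  assume f: "f \<in> annihilator r"
  show "Poly_Mapping.single c k * f \<in> annihilator r"
    unfolding annihilator_def mem_Collect_eq
  proof (intro allI impI)
    fix \<psi> :: "('v \<Rightarrow>\<^sub>0 nat) \<Rightarrow> 'k" assume "\<forall>a b. r a b \<longrightarrow> \<psi> a = \<psi> b"
    then have "functional (\<lambda>a. \<psi> (c + a)) f = 0"
      using assms by (intro annihilatorD[OF f]) auto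
    then show "functional \<psi> (Poly_Mapping.single c k * f) = 0"
      by (simp add: functional_single_mult)
  qed
qed (auto simp: annihilator_def functional_add)

lemma mon_mult: "mon a * mon b = mon (a + b)"
  by (simp add: mon_def mult_single)

lemma binomial_in_annihilator: "r a b \<Longrightarrow> mon a - mon b \<in> annihilator r"
  by (auto simp: annihilator_def mon_def functional_diff)

lemma binomial_in_annihilatorD:
  fixes r :: "('v \<Rightarrow>\<^sub>0 nat) \<Rightarrow> ('v \<Rightarrow>\<^sub>0 nat) \<Rightarrow> bool"
  assumes "equivp r" "mon a - mon b \<in> (annihilator r :: ('v, 'k :: comm_ring_1) mpol set)"
  shows "r a b"
proof -
  \<comment> \<open>The indicator of the class of \<open>a\<close> has value 1 at \<open>a\<close>,
    so it kills the binomial only if \<open>b\<close> lies in the class as well.\<close>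
  let ?\<psi> = "\<lambda>x. if r a x then 1 else 0 :: 'k"
  have "functional ?\<psi> (mon a - mon b) = 0"
    using assms(1) by (intro annihilatorD[OF assms(2)]) (metis equivp_symp equivp_transp)
  moreover have "r a a"
    using assms(1) by (rule equivp_reflp)
  ultimately show ?thesis
    by (auto simp: functional_diff mon_def split: if_splits)
qed

text \<open>A polynomial killed by all invariant functionals has, with every term, a second term in the
  same class; a multiple of the difference of the two monomials removes the first one.\<close>

lemma annihilator_eq:
  fixes r :: "('v \<Rightarrow>\<^sub>0 nat) \<Rightarrow> ('v \<Rightarrow>\<^sub>0 nat) \<Rightarrow> bool"
  assumes "equivp r" "\<And>a b c. r a b \<Longrightarrow> r (c + a) (c + b)"
  shows "(annihilator r :: ('v, 'k :: comm_ring_1) mpol set) = gideal {mon a - mon b | a b. r a b}"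
    (is "?J = gideal ?S")
proof
  note J = ideal_annihilator[of r, OF assms(2)]
  show "gideal ?S \<subseteq> ?J"
    using J by (rule gideal_subset) (auto intro: binomial_in_annihilator)
  show "?J \<subseteq> gideal ?S"
  proof
    fix f assume "f \<in> ?J"
    then show "f \<in> gideal ?S"
    proof (induction "card (Poly_Mapping.keys f)" arbitrary: f rule: less_induct)
      case (less f)
      show ?case
      proof (cases "f = 0")
        case False
        then obtain a where a: "a \<in> Poly_Mapping.keys f"
          by fastforce
        have "\<exists>b\<in>Poly_Mapping.keys f. b \<noteq> a \<and> r a b"
        proof (rule ccontr)
          assume n: "\<not> ?thesis"
          \<comment> \<open>If \<open>a\<close> were alone in its class within the support, this
            functional would return the nonzero coefficient at \<open>a\<close>.\<close>
          let ?\<psi> = "\<lambda>x. if r a x then 1 else 0 :: 'k"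
          have "functional ?\<psi> f = 0"
            using assms(1) by (intro annihilatorD[OF less.prems]) (metis equivp_symp equivp_transp)
          moreover have "functional ?\<psi> f = (\<Sum>x\<in>Poly_Mapping.keys f. if x = a then Poly_Mapping.lookup f x else 0)"
            unfolding functional_def key_sum_def using n equivp_reflp[OF assms(1), of a]
            by (intro sum.cong) auto
          ultimately show False
            using a by (simp add: sum.delta' in_keys_iff)
        qed
        then obtain b where b: "b \<in> Poly_Mapping.keys f" "b \<noteq> a" "r a b" by auto
        define s :: "('v, 'k) mpol" where "s = Poly_Mapping.single 0 (Poly_Mapping.lookup f a) * (mon a - mon b)"
        have s: "s = Poly_Mapping.single a (Poly_Mapping.lookup f a) - Poly_Mapping.single b (Poly_Mapping.lookup f a)"
          by (simp add: s_def mon_def right_diff_distrib mult_single)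
        have sS: "s \<in> gideal ?S"
          unfolding s_def using b by (intro gideal_mult gideal_base) auto
        have "s \<in> ?J"
          using J b(3) binomial_in_annihilator[of r a b] by (auto simp: s_def ideal_type_iff)
        moreover have "f - s = f + (- 1) * s" by simp
        ultimately have fs: "f - s \<in> ?J"
          using J less.prems unfolding ideal_type_iff by metis
        \<comment> \<open>The exponent \<open>b\<close> is already in the support, so the
          subtraction removes \<open>a\<close> without adding a new exponent.\<close>
        have "Poly_Mapping.keys (f - s) \<subseteq> Poly_Mapping.keys f - {a}"
          using b a by (auto simp: in_keys_iff lookup_minus s lookup_single when_def split: if_splits)
        then have "card (Poly_Mapping.keys (f - s)) < card (Poly_Mapping.keys f)"
          using a by (metis card_Diff1_less card_mono finite_Diff finite_keys le_less_trans)
        from gideal_add[OF less.hyps[OF this fs] sS] show ?thesis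
          by simp
      qed (simp add: gideal_zero)
    qed
  qed
qed

subsection \<open>Lattice ideals\<close>

lemma pos_part_lookup [simp]: "Poly_Mapping.lookup (pos_part a) i = nat (Poly_Mapping.lookup a i)"
  and neg_part_lookup [simp]: "Poly_Mapping.lookup (neg_part a) i = nat (- Poly_Mapping.lookup a i)"
  by (simp_all add: pos_part_def neg_part_def map.rep_eq when_def)

definition int_vec :: "('v \<Rightarrow>\<^sub>0 nat) \<Rightarrow> 'v \<Rightarrow>\<^sub>0 int" where
  "int_vec = Poly_Mapping.map int"

lemma int_vec_lookup [simp]: "Poly_Mapping.lookup (int_vec a) i = int (Poly_Mapping.lookup a i)"
  by (simp add: int_vec_def map.rep_eq when_def)

lemma int_vec_add: "int_vec (a + b) = int_vec a + int_vec b"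
  by (rule poly_mapping_eqI) (simp add: lookup_add)

lemma pos_part_minus_neg_part: "int_vec (pos_part a) - int_vec (neg_part a) = a"
  by (rule poly_mapping_eqI) (simp add: lookup_minus)

definition binom :: "('v \<Rightarrow>\<^sub>0 int) \<Rightarrow> ('v, 'k :: comm_ring_1) mpol" where
  "binom a = mon (pos_part a) - mon (neg_part a)"

lemma binom_uminus: "binom (- a) = - binom a"
  by (simp add: binom_def pos_part_def neg_part_def)

lemma binomial_mult_mon:
  fixes a b :: "'v :: finite \<Rightarrow>\<^sub>0 nat"
  obtains c where "mon a - mon b = mon c * (binom (int_vec a - int_vec b) :: ('v, 'k :: comm_ring_1) mpol)"
proof -
  \<comment> \<open>\<open>c\<close> is the coordinatewise minimum of \<open>a\<close> and
    \<open>b\<close>, the exponent of the greatest common divisor of the two monomials.\<close>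
  define c where "c = a - pos_part (int_vec a - int_vec b)"
  have "c + pos_part (int_vec a - int_vec b) = a" "c + neg_part (int_vec a - int_vec b) = b"
    by (rule poly_mapping_eqI, simp add: c_def lookup_add lookup_minus)+
  then show thesis
    by (intro that[of c]) (simp add: binom_def right_diff_distrib mon_mult)
qed

abbreviation lattice :: "('v \<Rightarrow>\<^sub>0 int) set \<Rightarrow> bool" where
  "lattice L \<equiv> subgroup L (free_Abelian_group UNIV)"

lemma lattice_iff: "lattice L \<longleftrightarrow> 0 \<in> L \<and> (\<forall>x\<in>L. \<forall>y\<in>L. x + y \<in> L) \<and> (\<forall>x\<in>L. - x \<in> L)"
  by (auto simp: subgroup_def)

lemma lattice_zero: "lattice L \<Longrightarrow> 0 \<in> L"
  and lattice_add: "lattice L \<Longrightarrow> x \<in> L \<Longrightarrow> y \<in> L \<Longrightarrow> x + y \<in> L"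
  and lattice_uminus: "lattice L \<Longrightarrow> x \<in> L \<Longrightarrow> - x \<in> L"
  by (auto simp: lattice_iff)

lemma lattice_diff: "lattice L \<Longrightarrow> x \<in> L \<Longrightarrow> y \<in> L \<Longrightarrow> x - y \<in> L"
  using lattice_add[of L x "- y"] lattice_uminus[of L y] by simp

lemma lattice_cmul:
  assumes "lattice L" "x \<in> L"
  shows "frag_cmul n x \<in> L"
proof -
  have nat: "frag_cmul (int m) x \<in> L" for m
    by (induction m) (use assms in \<open>auto simp: frag_cmul_distrib intro: lattice_zero lattice_add\<close>)
  show ?thesis
    using nat[of "nat n"] lattice_uminus[OF assms(1) nat[of "nat (- n)"]]
    by (cases "0 \<le> n") auto
qed

definition lattice_rel :: "('v \<Rightarrow>\<^sub>0 int) set \<Rightarrow> ('v \<Rightarrow>\<^sub>0 nat) \<Rightarrow> ('v \<Rightarrow>\<^sub>0 nat) \<Rightarrow> bool" where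
  "lattice_rel L a b \<longleftrightarrow> int_vec a - int_vec b \<in> L"

lemma lattice_rel_equivp:
  assumes L: "lattice L"
  shows "equivp (lattice_rel L)"
proof (rule equivpI)
  show "reflp (lattice_rel L)"
    using lattice_zero[OF L] by (simp add: reflp_def lattice_rel_def)
  show "symp (lattice_rel L)"
    using lattice_uminus[OF L] by (fastforce simp: symp_def lattice_rel_def)
  show "transp (lattice_rel L)"
    using lattice_add[OF L] by (fastforce simp: transp_def lattice_rel_def)
qed

lemma lattice_rel_add: "lattice_rel L a b \<Longrightarrow> lattice_rel L (c + a) (c + b)"
  by (simp add: lattice_rel_def int_vec_add)

text \<open>The difference of two congruent monomials is a monomial multiple of \<open>binom\<close>
  of their exponent difference, so both sides have the same generators up to monomial
  factors.\<close>

lemma annihilator_lattice_rel: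
  fixes L :: "('v :: finite \<Rightarrow>\<^sub>0 int) set"
  assumes L: "lattice L"
  shows "(annihilator (lattice_rel L) :: ('v, 'k :: comm_ring_1) mpol set) = gideal (binom ` L)"
    (is "?J = ?I")
proof
  have "mon a - mon b \<in> ?I" if ab: "lattice_rel L a b" for a b
  proof -
    obtain c where "mon a - mon b = mon c * (binom (int_vec a - int_vec b) :: ('v, 'k) mpol)"
      by (rule binomial_mult_mon)
    then show ?thesis
      using ab by (auto simp: lattice_rel_def intro: gideal_mult gideal_base)
  qed
  then have "gideal {mon a - mon b | a b. lattice_rel L a b} \<subseteq> ?I"
    by (intro gideal_subset_gideal) auto
  moreover have "?J = gideal {mon a - mon b | a b. lattice_rel L a b}"
    using L by (intro annihilator_eq lattice_rel_equivp lattice_rel_add)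
  ultimately show "?J \<subseteq> ?I"
    by simp
  show "?I \<subseteq> ?J"
    by (intro gideal_subset ideal_annihilator lattice_rel_add)
       (auto simp: binom_def lattice_rel_def pos_part_minus_neg_part
             intro!: binomial_in_annihilator)
qed

lemma binomial_in_lattice_ideal:
  fixes L :: "('v :: finite \<Rightarrow>\<^sub>0 int) set"
  assumes L: "lattice L"
  shows "mon a - mon b \<in> (gideal (binom ` L) :: ('v, 'k :: comm_ring_1) mpol set) \<longleftrightarrow>
    int_vec a - int_vec b \<in> L"
  using binomial_in_annihilator[of "lattice_rel L" a b]
    binomial_in_annihilatorD[OF lattice_rel_equivp[OF L], of a b]
  unfolding annihilator_lattice_rel[OF L] lattice_rel_def by blast

section \<open>Principal and prime lattice ideals\<close>

lemma mon_power_eq: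
  assumes "\<And>i. Poly_Mapping.lookup b i = n * Poly_Mapping.lookup a i"
  shows "mon a ^ n = (mon b :: ('v, 'k :: comm_ring_1) mpol)"
  using assms
proof (induction n arbitrary: b)
  case 0
  then have "b = 0"
    by (intro poly_mapping_eqI) simp
  then show ?case
    by (simp add: mon_def)
next
  case (Suc n)
  have "mon a ^ n = (mon (b - a) :: ('v, 'k) mpol)"
    by (rule Suc.IH) (simp add: Suc.prems lookup_minus)
  moreover have "a + (b - a) = b"
    by (rule poly_mapping_eqI) (simp add: Suc.prems lookup_minus lookup_add)
  ultimately show ?case
    by (simp add: mon_mult)
qed

text \<open>With \<open>X\<close> and \<open>Y\<close> the two monomials of \<open>binom w\<close>,
  \<open>X - Y\<close> divides \<open>X ^ m - Y ^ m\<close>; negative multiples differ only by a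
  sign.\<close>

lemma binomial_multiple:
  "binom (frag_cmul n w) \<in> (gideal {binom w} :: ('v, 'k :: comm_ring_1) mpol set)"
proof -
  have nat: "binom (frag_cmul (int m) w) \<in> (gideal {binom w} :: ('v, 'k) mpol set)" for m
  proof -
    have "nat (- (int m * x)) = m * nat (- x)" for x
      using nat_mult_distrib[of "int m" "- x"] by simp
    then have "binom (frag_cmul (int m) w) = (mon (pos_part w) ^ m - mon (neg_part w) ^ m :: ('v, 'k) mpol)"
      unfolding binom_def
      by (intro arg_cong2[of _ _ _ _ "(-)"] mon_power_eq[symmetric])
         (simp_all add: nat_mult_distrib)
    also have "\<dots> = (\<Sum>i<m. mon (neg_part w) ^ (m - Suc i) * mon (pos_part w) ^ i) * binom w"
      unfolding binom_def by (subst power_diff_sumr2) (rule mult.commute)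
    also have "\<dots> \<in> gideal {binom w}"
      by (intro gideal_mult gideal_base) simp
    finally show ?thesis .
  qed
  show ?thesis
    using nat[of "nat n"] gideal_uminus[OF nat[of "nat (- n)"]]
    by (cases "0 \<le> n") (auto simp flip: binom_uminus)
qed

lemma gideal_binomial_multiples:
  assumes "w \<in> L" "\<And>x. x \<in> L \<Longrightarrow> \<exists>n. x = frag_cmul n w"
  shows "gideal (binom ` L) = gideal {binom w}"
proof (intro antisym gideal_subset_gideal)
  show "binom ` L \<subseteq> gideal {binom w}"
    using assms(2) binomial_multiple by blast
  show "{binom w} \<subseteq> gideal (binom ` L)"
    using assms(1) by (simp add: gideal_base)
qed

text \<open>The ideal is the kernel of \<open>push g\<close>, which maps into the monoid algebra of
  a linearly ordered group over a domain; such an algebra has no zero divisors.\<close>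

lemma lattice_ideal_prime:
  fixes \<phi> :: "('v :: finite \<Rightarrow>\<^sub>0 int) \<Rightarrow> 'b :: linordered_ab_group_add"
  assumes add: "\<And>x y. \<phi> (x + y) = \<phi> x + \<phi> y"
  shows "primeideal (gideal (binom ` {x. \<phi> x = 0}) :: ('v, 'k :: idom) mpol set) mpol_ring"
proof -
  let ?L = "{x. \<phi> x = 0}"
  define g where "g a = \<phi> (int_vec a)" for a
  have g: "g (a + b) = g a + g b" for a b
    by (simp add: g_def int_vec_add add)
  have zero: "\<phi> 0 = 0"
    using add[of 0 0] by simp
  have uminus: "\<phi> (- x) = - \<phi> x" for x
    using add[of x "- x"] zero by (simp add: add_eq_0_iff)
  have L: "lattice ?L"
    by (simp add: lattice_iff zero uminus add)
  have rel: "lattice_rel ?L a b \<longleftrightarrow> g a = g b" for a b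
    using add[of "int_vec a" "- int_vec b"] by (simp add: lattice_rel_def g_def uminus)
  have "gideal (binom ` ?L) = {f :: ('v, 'k) mpol. push g f = 0}"
  proof
    have "g (pos_part x) = g (neg_part x)" if "\<phi> x = 0" for x
      using that by (simp flip: rel add: lattice_rel_def pos_part_minus_neg_part)
    then show "gideal (binom ` ?L) \<subseteq> {f :: ('v, 'k) mpol. push g f = 0}"
      by (intro gideal_subset)
         (auto simp: ideal_type_iff push_add push_mult g binom_def push_diff mon_def)
  next
    show "{f. push g f = 0} \<subseteq> (gideal (binom ` ?L) :: ('v, 'k) mpol set)"
    proof
    fix f :: "('v, 'k) mpol" assume f: "f \<in> {f. push g f = 0}"
    have "f \<in> annihilator (lattice_rel ?L)"
      unfolding annihilator_def mem_Collect_eq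
    proof (intro allI impI)
      fix \<psi> :: "('v \<Rightarrow>\<^sub>0 nat) \<Rightarrow> 'k"
      assume \<psi>: "\<forall>a b. lattice_rel ?L a b \<longrightarrow> \<psi> a = \<psi> b"
      \<comment> \<open>A representative is chosen for each value of \<open>g\<close>, so that
        \<open>\<psi>\<close> factors through \<open>g\<close> and its functional through
        \<open>push g\<close>.\<close>
      have "lattice_rel ?L (SOME b. g b = g a) a" for a
        unfolding rel by (rule someI[where P = "\<lambda>b. g b = g a"]) rule
      with \<psi> have "\<psi> (SOME b. g b = g a) = \<psi> a" for a
        by blast
      then have "functional \<psi> f = functional (\<lambda>y. \<psi> (SOME b. g b = y)) (push g f)"
        by (simp add: functional_push)
      with f show "functional \<psi> f = 0"
        by simp
    qed
    then show "f \<in> gideal (binom ` ?L)"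
      by (simp add: annihilator_lattice_rel[OF L])
    qed
  qed
  moreover have "primeideal {f :: ('v, 'k) mpol. push g f = 0} mpol_ring"
    unfolding primeideal_type_iff
  proof (intro conjI)
    have "Poly_Mapping.keys (push g (Poly_Mapping.single 0 1 :: ('v, 'k) mpol)) = {g 0}"
      by (subst push_single) simp
    then have "push g (Poly_Mapping.single 0 1 :: ('v, 'k) mpol) \<noteq> 0"
      by (metis insert_not_empty keys_zero)
    then show "{f :: ('v, 'k) mpol. push g f = 0} \<noteq> UNIV"
      by blast
  qed (auto simp: ideal_type_iff push_add push_mult g)
  ultimately show ?thesis
    by simp
qed

subsection \<open>Homogeneity and height\<close>

lemma hom_component_conv_key_sum:
  "hom_component d n = key_sum (\<lambda>a c. if wdeg d a = n then Poly_Mapping.single a c else 0)"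
  by (auto simp: fun_eq_iff hom_component_def key_sum_def sum.inter_filter intro!: sum.cong)

lemma hom_component_zero [simp]: "hom_component d n 0 = 0"
  and hom_component_add: "hom_component d n (f + g) = hom_component d n f + hom_component d n g"
  and hom_component_diff: "hom_component d n (f - g) = hom_component d n f - hom_component d n g"
  and hom_component_single: "hom_component d n (Poly_Mapping.single a c) =
    (if wdeg d a = n then Poly_Mapping.single a c else 0)"
  by (simp_all add: hom_component_conv_key_sum key_sum_add key_sum_diff key_sum_single single_add)

lemma wdeg_add: "wdeg d (a + b) = wdeg d a + wdeg d b"
  by (simp add: wdeg_def lookup_add distrib_left sum.distrib)

lemma hom_component_mon_mult:
  "hom_component d n (mon a * f) =
     (if wdeg d a \<le> n then mon a * hom_component d (n - wdeg d a) f else 0)"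
proof (induction f rule: poly_mapping_single_induct)
  case (add b c f)
  then show ?case
    by (auto simp: distrib_left hom_component_add mon_def mult_single hom_component_single wdeg_add)
qed simp

lemma hom_components_zero:
  assumes "\<And>n. hom_component d n f = 0"
  shows "f = 0"
proof (rule poly_mapping_eqI)
  fix a
  have "Poly_Mapping.lookup (hom_component d (wdeg d a) f) a = Poly_Mapping.lookup f a"
    by (auto simp: hom_component_def lookup_sum lookup_single when_def sum.delta in_keys_iff)
  then show "Poly_Mapping.lookup f a = Poly_Mapping.lookup 0 a"
    by (simp add: assms)
qed

text \<open>Dividing an element of \<open>Q\<close> by \<open>p\<close> gives an element of \<open>Q\<close> again, so the homogeneous
  components of elements of \<open>Q\<close> vanish by descent on their degree.\<close>

lemma no_prime_below_homogeneous_binomial: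
  fixes p :: "('v :: finite, 'k :: comm_ring_1) mpol"
  assumes p: "p = mon a - mon b" "wdeg d a = wdeg d b" "0 < wdeg d b"
    and Q: "primeideal Q mpol_ring" "primeideal Q' mpol_ring" "Q' \<subset> Q"
  shows "\<not> Q \<subset> gideal {p}"
proof
  assume sub: "Q \<subset> gideal {p}"
  have "p \<notin> Q"
    using sub gideal_subset[of Q "{p}"] Q(1) by (auto simp: primeideal_type_iff)
  have "hom_component d n q = 0" if "q \<in> Q" for n q
    using that
  proof (induction n arbitrary: q rule: less_induct)
    case (less n)
    obtain r where r: "q = r * p"
      using less.prems sub in_gideal_singleton[of q p] by blast
    with Q(1) less.prems \<open>p \<notin> Q\<close> have "r \<in> Q"
      by (auto simp: primeideal_type_iff)
    have "q = mon a * r - mon b * r"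
      by (simp add: r p algebra_simps)
    then show ?case
      using less.IH[of "n - wdeg d b" r] \<open>r \<in> Q\<close> p(2,3)
      by (auto simp: hom_component_diff hom_component_mon_mult)
  qed
  \<comment> \<open>So \<open>Q\<close> is the zero ideal, which leaves no room for a strictly
    smaller prime \<open>Q'\<close>.\<close>
  then have "Q \<subseteq> {0}"
    using hom_components_zero by blast
  moreover have "0 \<in> Q'"
    using Q(2) by (auto simp: primeideal_type_iff ideal_type_iff)
  ultimately show False
    using Q(3) by blast
qed

lemma wdeg_diff:
  fixes d :: "'v :: finite \<Rightarrow> nat"
  shows "(\<Sum>i\<in>UNIV. int (d i) * Poly_Mapping.lookup (int_vec a - int_vec b) i) = int (wdeg d a) - int (wdeg d b)"
  by (simp add: wdeg_def lookup_minus right_diff_distrib sum_subtractf)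

text \<open>If the two monomials of \<open>binom w\<close> had different degrees, one of them would
  be a homogeneous component and lie in the ideal; the sum of the coefficients, which vanishes on
  the ideal, rules this out.\<close>

lemma homogeneous_lattice_ideal:
  fixes L :: "('v :: finite \<Rightarrow>\<^sub>0 int) set"
  assumes L: "lattice L" and hom: "homogeneous_wrt d (gideal (binom ` L) :: ('v, 'k :: comm_ring_1) mpol set)"
    and w: "w \<in> L"
  shows "(\<Sum>i\<in>UNIV. int (d i) * Poly_Mapping.lookup w i) = 0"
proof (rule ccontr)
  assume "\<not> ?thesis"
  with wdeg_diff[of d "pos_part w" "neg_part w"]
  have ne: "wdeg d (neg_part w) \<noteq> wdeg d (pos_part w)"
    by (auto simp: pos_part_minus_neg_part)
  have "hom_component d (wdeg d (pos_part w)) (binom w) \<in> (gideal (binom ` L) :: ('v, 'k) mpol set)"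
    using hom w by (auto simp: homogeneous_wrt_def gideal_base)
  then have "mon (pos_part w) \<in> (annihilator (lattice_rel L) :: ('v, 'k) mpol set)"
    using ne by (simp add: annihilator_lattice_rel[OF L] binom_def mon_def hom_component_diff hom_component_single)
  then have "functional (\<lambda>_. 1) (mon (pos_part w) :: ('v, 'k) mpol) = 0"
    by (rule annihilatorD) simp
  then show False
    by (simp add: mon_def)
qed

section \<open>Lattices of rank one and height\<close>

abbreviation coord :: "('v \<Rightarrow>\<^sub>0 int) \<Rightarrow> 'v \<Rightarrow> int" (infixl \<open>!!\<close> 100) where
  "w !! i \<equiv> Poly_Mapping.lookup w i"

definition orthogonal :: "('v :: finite \<Rightarrow> nat) \<Rightarrow> ('v \<Rightarrow>\<^sub>0 int) \<Rightarrow> bool" where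
  "orthogonal d w \<longleftrightarrow> (\<Sum>i\<in>UNIV. int (d i) * w !! i) = 0"

lemma orthogonal_nonpos:
  assumes d: "\<And>i. 0 < d i" and w: "orthogonal d w" "\<And>i. w !! i \<le> 0"
  shows "w = 0"
proof (rule poly_mapping_eqI)
  fix i
  have "(\<Sum>i\<in>UNIV. int (d i) * - w !! i) = 0"
    using w(1) by (simp add: orthogonal_def sum_negf)
  then have "int (d i) * - w !! i = 0"
    using w(2) by (subst (asm) sum_nonneg_eq_0_iff) (auto simp: mult_nonneg_nonpos)
  with d[of i] show "w !! i = 0 !! i"
    by simp
qed

text \<open>The vectors proportional to \<open>u\<close> are the multiples of the one whose \<open>i\<close>-th coordinate is
  positive and minimal. They form the kernel of an additive map into a linearly ordered group,
  hence a prime lattice ideal, which is generated by a single binom.\<close>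

lemma proportional_multiples:
  fixes u :: "'v \<Rightarrow>\<^sub>0 int"
  assumes u: "u !! i \<noteq> 0"
  obtains w where "frag_cmul (u !! i) w - frag_cmul (w !! i) u = 0" "0 < w !! i"
    "\<And>x. frag_cmul (u !! i) x - frag_cmul (x !! i) u = 0 \<Longrightarrow> \<exists>n. x = frag_cmul n w"
proof -
  let ?\<phi> = "\<lambda>x. frag_cmul (u !! i) x - frag_cmul (x !! i) u"
  define v where "v = (if 0 < u !! i then u else - u)"
  have "?\<phi> v = 0" "0 < v !! i"
    using u by (auto simp: v_def intro!: poly_mapping_eqI)
  then obtain w where w: "?\<phi> w = 0" "0 < w !! i"
    and least: "\<And>x. ?\<phi> x = 0 \<Longrightarrow> 0 < x !! i \<Longrightarrow> nat (w !! i) \<le> nat (x !! i)"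
    using ex_has_least_nat[of "\<lambda>x. ?\<phi> x = 0 \<and> 0 < x !! i" v "\<lambda>x. nat (x !! i)"] by blast
  show thesis
  proof (rule that[OF w])
    fix x assume x: "?\<phi> x = 0"
    \<comment> \<open>Division with remainder by \<open>w\<close>: the remainder \<open>y\<close> is
      proportional to \<open>u\<close> and its \<open>i\<close>-th coordinate is below the minimum,
      hence 0, so \<open>y = 0\<close>.\<close>
    define q where "q = x !! i div w !! i"
    define y where "y = x - frag_cmul q w"
    have "?\<phi> y = ?\<phi> x - frag_cmul q (?\<phi> w)"
      by (rule poly_mapping_eqI) (simp add: y_def lookup_add lookup_minus algebra_simps)
    then have y: "?\<phi> y = 0"
      using x w by simp
    have yi: "y !! i = x !! i mod w !! i"
      by (simp add: y_def q_def lookup_minus minus_div_mult_eq_mod)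
    with w have "0 \<le> y !! i" "y !! i < w !! i"
      by simp_all
    with least[OF y] have "y !! i = 0"
      by (cases "y !! i = 0") auto
    with y u have "y = 0"
      by simp
    then have "x = frag_cmul q w"
      by (simp add: y_def)
    then show "\<exists>n. x = frag_cmul n w" ..
  qed
qed

text \<open>The vectors of \<open>L\<close> are proportional to \<open>u\<close>, so the ideal lies
  in the prime \<open>P\<close>, which is generated by one homogeneous binomial of positive
  degree.\<close>

lemma height_rank_one:
  fixes L :: "('v :: {finite, linorder} \<Rightarrow>\<^sub>0 int) set"
  assumes d: "\<And>i. 0 < d i" and u: "u !! i \<noteq> 0" "orthogonal d u"
    and L: "\<And>x. x \<in> L \<Longrightarrow> frag_cmul (u !! i) x = frag_cmul (x !! i) u"
  shows "height mpol_ring (gideal (binom ` L) :: ('v, 'k :: idom) mpol set) < 2"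
proof -
  let ?\<phi> = "\<lambda>x. frag_cmul (u !! i) x - frag_cmul (x !! i) u"
  obtain w where w: "?\<phi> w = 0" "0 < w !! i" "\<And>x. ?\<phi> x = 0 \<Longrightarrow> \<exists>n. x = frag_cmul n w"
    using proportional_multiples[OF u(1)] by blast
  define P :: "('v, 'k) mpol set" where "P = gideal (binom ` {x. ?\<phi> x = 0})"
  have P: "P = gideal {binom w}"
    unfolding P_def using w by (intro gideal_binomial_multiples) auto
  have "orthogonal d w"
  proof -
    have "u !! i * w !! j = w !! i * u !! j" for j
      using w(1) by (metis eq_iff_diff_eq_0 lookup_frag_cmul)
    then have "u !! i * (\<Sum>j\<in>UNIV. int (d j) * w !! j) = w !! i * (\<Sum>j\<in>UNIV. int (d j) * u !! j)"
      by (simp add: sum_distrib_left mult.left_commute)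
    with u show ?thesis
      by (simp add: orthogonal_def)
  qed
  then have eq: "wdeg d (pos_part w) = wdeg d (neg_part w)"
    using wdeg_diff[of d "pos_part w" "neg_part w"]
    by (simp add: pos_part_minus_neg_part orthogonal_def)
  have "0 < wdeg d (pos_part w)"
    unfolding wdeg_def using d[of i] w(2) by (intro sum_pos2[of _ i]) auto
  show ?thesis
  proof (rule height_less_two)
    \<comment> \<open>The values of \<open>?\<phi>\<close> are integer vectors, linearly ordered by
      means of the order on the index type.\<close>
    show "primeideal P mpol_ring"
      unfolding P_def by (intro lattice_ideal_prime)
        (auto intro!: poly_mapping_eqI simp: lookup_add lookup_minus algebra_simps)
    show "gideal (binom ` L) \<subseteq> P"
      unfolding P_def using L by (intro gideal_subset_gideal) (auto intro!: gideal_base)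
    show "\<not> Q \<subset> P" if "primeideal Q mpol_ring" "primeideal Q' mpol_ring" "Q' \<subset> Q" for Q Q'
      unfolding P
      using no_prime_below_homogeneous_binomial[OF binom_def eq _ that] eq
        \<open>0 < wdeg d (pos_part w)\<close> by simp
  qed
qed

section \<open>Graded lattices in three variables\<close>

lemma third_index:
  fixes i j :: 3
  assumes "i \<noteq> j"
  obtains k where "k \<noteq> i" "k \<noteq> j" "UNIV = {i, j, k}"
proof -
  have "card (UNIV - {i, j}) = 1"
    using assms by (simp add: card_Diff_subset)
  then obtain k where "UNIV - {i, j} = {k}"
    by (rule card_1_singletonE)
  then show thesis
    by (intro that[of k]) blast+
qed

lemma other_indices:
  fixes i :: 3
  obtains j k where "i \<noteq> j" "k \<noteq> i" "k \<noteq> j" "UNIV = {i, j, k}"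
proof -
  have "i \<noteq> i + 1"
    by simp
  then show thesis
    using third_index that by metis
qed

locale graded_lattice =
  fixes L :: "(3 \<Rightarrow>\<^sub>0 int) set" and d :: "3 \<Rightarrow> nat"
  assumes lat: "lattice L" and d_pos: "\<And>i. 0 < d i" and orth: "\<And>w. w \<in> L \<Longrightarrow> orthogonal d w"
begin

lemma nonpos: "w \<in> L \<Longrightarrow> (\<And>i. w !! i \<le> 0) \<Longrightarrow> w = 0"
  using orthogonal_nonpos[OF d_pos orth] .

lemma nonneg: "w \<in> L \<Longrightarrow> (\<And>i. 0 \<le> w !! i) \<Longrightarrow> w = 0"
  using nonpos[OF lattice_uminus[OF lat], of w] by simp

text \<open>The sign pattern of the exponent difference of an \<open>indet i\<close>-pure binomial.
  Orthogonality to \<open>d\<close> makes some other coordinate negative, so the second monomial is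
  not constant.\<close>

definition pure :: "3 \<Rightarrow> (3 \<Rightarrow>\<^sub>0 int) \<Rightarrow> bool" where
  "pure i w \<longleftrightarrow> w \<in> L \<and> 0 < w !! i \<and> (\<forall>j. j \<noteq> i \<longrightarrow> w !! j \<le> 0)"

text \<open>Up to sign the \<open>i\<close>-th coordinate is positive; a nonnegative third
  coordinate would then contradict orthogonality to \<open>d\<close>.\<close>

lemma pure_of_zero_coord:
  assumes w: "w \<in> L" "w !! i \<noteq> 0" "w !! j = 0" "i \<noteq> j"
  shows "\<exists>v. pure i v"
proof -
  obtain k where k: "k \<noteq> i" "k \<noteq> j" "UNIV = {i, j, k}"
    using third_index[OF w(4)] .
  define v where "v = (if 0 < w !! i then w else - w)"
  have v: "v \<in> L" "0 < v !! i" "v !! j = 0"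
    using w lattice_uminus[OF lat] by (auto simp: v_def)
  have "v !! k \<le> 0"
  proof (rule ccontr)
    assume "\<not> v !! k \<le> 0"
    then have "0 \<le> v !! l" for l
      using v UNIV_I[of l] unfolding k(3) by auto
    from nonneg[OF v(1) this] v(2) show False
      by simp
  qed
  moreover have "l = i \<or> l = j \<or> l = k" for l
    using UNIV_I[of l] unfolding k(3) by simp
  ultimately have "pure i v"
    using v unfolding pure_def by (metis order_refl)
  then show ?thesis ..
qed

text \<open>Height two excludes rank at most one. If \<open>L\<close> has a vector with nonzero
  \<open>i\<close>-th coordinate, elimination produces one that also has a zero coordinate;
  otherwise \<open>L\<close> lies on a line.\<close>

lemma pure_exists:
  assumes height: "height mpol_ring (gideal (binom ` L) :: (3, 'k :: idom) mpol set) = 2"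
  shows "\<exists>w. pure i w"
proof (cases "\<exists>u\<in>L. u !! i \<noteq> 0")
  case True
  then obtain u where u: "u \<in> L" "u !! i \<noteq> 0" ..
  have "\<exists>v\<in>L. frag_cmul (u !! i) v \<noteq> frag_cmul (v !! i) u"
    using height_rank_one[OF d_pos u(2) orth[OF u(1)], of L, where 'k = 'k] height by auto
  then obtain v where v: "v \<in> L" "frag_cmul (u !! i) v \<noteq> frag_cmul (v !! i) u" ..
  define z where "z = frag_cmul (u !! i) v - frag_cmul (v !! i) u"
  have "z \<noteq> 0"
    using v by (simp add: z_def)
  then obtain j where j: "z !! j \<noteq> 0"
    by (metis poly_mapping_eqI lookup_zero)
  have zi: "z !! i = 0"
    by (simp add: z_def lookup_minus)
  with j have "i \<noteq> j" by auto
  \<comment> \<open>As \<open>z !! i = 0\<close>, eliminating the \<open>j\<close>-th coordinate of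
    \<open>u\<close> by means of \<open>z\<close> keeps the \<open>i\<close>-th one nonzero.\<close>
  let ?w = "frag_cmul (z !! j) u - frag_cmul (u !! j) z"
  have "z \<in> L"
    unfolding z_def using u v by (intro lattice_diff lattice_cmul lat)
  then have "?w \<in> L"
    using u by (intro lattice_diff lattice_cmul lat)
  moreover have "?w !! i \<noteq> 0" "?w !! j = 0"
    using u j zi by (simp_all add: lookup_minus)
  ultimately show ?thesis
    using pure_of_zero_coord \<open>i \<noteq> j\<close> by blast
next
  case False
  obtain j k where jk: "i \<noteq> j" "k \<noteq> i" "k \<noteq> j" "UNIV = {i, j, k}"
    by (rule other_indices)
  \<comment> \<open>Over the rationals \<open>u\<close> spans the vectors orthogonal to
    \<open>d\<close> with zero \<open>i\<close>-th coordinate, so all of \<open>L\<close> is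
    proportional to it.\<close>
  define u where "u = frag_cmul (int (d k)) (frag_of j) - frag_cmul (int (d j)) (frag_of k)"
  have u: "u !! i = 0" "u !! j = int (d k)" "u !! k = - int (d j)"
    using jk by (auto simp: u_def lookup_minus lookup_single_not_eq)
  have "orthogonal d u"
    using jk by (auto simp: orthogonal_def jk(4) u)
  moreover have "frag_cmul (u !! j) x = frag_cmul (x !! j) u" if x: "x \<in> L" for x
  proof (rule poly_mapping_eqI)
    fix l
    have xi: "x !! i = 0"
      using False x by blast
    have "int (d j) * x !! j + int (d k) * x !! k = 0"
      using orth[OF x] jk(1-3) xi by (auto simp: orthogonal_def jk(4))
    moreover have "l = i \<or> l = j \<or> l = k"
      using UNIV_I[of l] unfolding jk(4) by simp
    ultimately show "frag_cmul (u !! j) x !! l = frag_cmul (x !! j) u !! l"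
      using u xi by (auto simp: algebra_simps)
  qed
  ultimately have "height mpol_ring (gideal (binom ` L) :: (3, 'k) mpol set) < 2"
    using u(2) d_pos[of k] by (intro height_rank_one[OF d_pos, of u j]) auto
  with height show ?thesis
    by simp
qed

end

subsection \<open>Critical vectors\<close>

lemma monomial_ideal:
  assumes "\<And>a c. a \<in> U \<Longrightarrow> c + a \<in> U"
  shows "ideal {f :: ('v, 'k :: comm_ring_1) mpol. Poly_Mapping.keys f \<subseteq> U} mpol_ring"
proof (rule ideal_mpolI)
  fix f :: "('v, 'k) mpol" and c k
  assume "f \<in> {f. Poly_Mapping.keys f \<subseteq> U}"
  then show "Poly_Mapping.single c k * f \<in> {f. Poly_Mapping.keys f \<subseteq> U}"
    using keys_mult[of "Poly_Mapping.single c k" f] assms by (fastforce split: if_splits)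
next
  fix f g :: "('v, 'k) mpol"
  assume "f \<in> {f. Poly_Mapping.keys f \<subseteq> U}" "g \<in> {f. Poly_Mapping.keys f \<subseteq> U}"
  then show "f + g \<in> {f. Poly_Mapping.keys f \<subseteq> U}"
    using keys_add[of f g] by blast
qed simp

lemma pos_part_eq_neg_part: "pos_part w = neg_part w \<Longrightarrow> w = 0"
  using pos_part_minus_neg_part[of w] by simp

text \<open>The generators lie in the ideal of polynomials supported in the upward closed set
  \<open>U\<close>, while \<open>binom v\<close> has coefficient 1 at an exponent outside
  \<open>U\<close>.\<close>

lemma binomial_notin_gideal:
  fixes S :: "('v \<Rightarrow>\<^sub>0 int) set"
  assumes U: "\<And>a c. a \<in> U \<Longrightarrow> c + a \<in> U"
    and S: "\<And>w. w \<in> S \<Longrightarrow> pos_part w \<in> U \<and> neg_part w \<in> U"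
    and v: "v \<noteq> 0" "pos_part v \<notin> U"
  shows "binom v \<notin> (gideal (binom ` S) :: ('v, 'k :: comm_ring_1) mpol set)"
proof
  assume "binom v \<in> (gideal (binom ` S) :: ('v, 'k) mpol set)"
  moreover have "binom w \<in> {f :: ('v, 'k) mpol. Poly_Mapping.keys f \<subseteq> U}" if "w \<in> S" for w
    using keys_diff[of "mon (pos_part w) :: ('v, 'k) mpol" "mon (neg_part w)"] S[OF that]
    by (auto simp: binom_def mon_def)
  then have "gideal (binom ` S) \<subseteq> {f :: ('v, 'k) mpol. Poly_Mapping.keys f \<subseteq> U}"
    by (intro gideal_subset monomial_ideal U) auto
  ultimately have "Poly_Mapping.keys (binom v :: ('v, 'k) mpol) \<subseteq> U"
    by blast
  moreover have "Poly_Mapping.lookup (binom v :: ('v, 'k) mpol) (pos_part v) = 1"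
    using pos_part_eq_neg_part[of v] v(1)
    by (auto simp: binom_def mon_def lookup_minus lookup_single when_def)
  ultimately show False
    using v(2) by (metis in_keys_iff subsetD zero_neq_one)
qed

text \<open>A proper subset of \<open>G\<close> misses some \<open>x\<close>, so its ideal lies in
  the one generated by \<open>G - {x}\<close>.\<close>

lemma minimally_generatedI:
  assumes "gideal G = I" "\<And>x. x \<in> G \<Longrightarrow> x \<notin> gideal (G - {x})"
  shows "minimally_generated ring_of_type_algebra I G"
  unfolding minimally_generated_def
proof (intro conjI allI impI assms(1) notI)
  fix H assume H: "H \<subset> G" "gideal H = I"
  then obtain x where x: "x \<in> G" "x \<notin> H" by blast
  then have "gideal H \<subseteq> gideal (G - {x})"
    using H(1) by (intro gideal_subset_gideal) (auto intro!: gideal_base)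
  moreover have "x \<in> gideal H"
    using x H(2) assms(1) by (auto intro: gideal_base)
  ultimately show False
    using assms(2)[OF x(1)] by blast
qed

lemma gideal_mono: "S \<subseteq> T \<Longrightarrow> gideal S \<subseteq> gideal T"
  by (intro gideal_subset_gideal) (auto intro: gideal_base)

lemma mon_diff_in_multiples:
  fixes a b :: "'v :: finite \<Rightarrow>\<^sub>0 nat"
  assumes "int_vec a - int_vec b = frag_cmul n x"
  shows "mon a - mon b \<in> (gideal {binom x} :: ('v, 'k :: comm_ring_1) mpol set)"
proof -
  obtain c where "mon a - mon b = mon c * (binom (frag_cmul n x) :: ('v, 'k) mpol)"
    using binomial_mult_mon[of a b] unfolding assms by blast
  then show ?thesis
    by (simp add: gideal_mult binomial_multiple)
qed

lemma indet_power: "indet i ^ n = mon (Poly_Mapping.single i n)"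
  unfolding indet_def by (rule mon_power_eq) (simp add: lookup_single when_def)

section \<open>Critical vectors and critical binomials\<close>

context graded_lattice
begin

definition crit :: "3 \<Rightarrow> (3 \<Rightarrow>\<^sub>0 int) \<Rightarrow> bool" where
  "crit i w \<longleftrightarrow> pure i w \<and> (\<forall>v. pure i v \<longrightarrow> w !! i \<le> v !! i)"

lemma crit_exists:
  assumes "\<exists>w. pure i w"
  shows "\<exists>w. crit i w"
proof -
  obtain w where w: "pure i w" "\<And>v. pure i v \<Longrightarrow> nat (w !! i) \<le> nat (v !! i)"
    using ex_has_least_nat[of "pure i" _ "\<lambda>w. nat (w !! i)"] assms by blast
  have "w !! i \<le> v !! i" if "pure i v" for v
    using w(2)[OF that] that by (auto simp: pure_def)
  with w(1) show ?thesis
    unfolding crit_def by blast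
qed

lemma critD:
  assumes "crit i w"
  shows "w \<in> L" "0 < w !! i" "j \<noteq> i \<Longrightarrow> w !! j \<le> 0"
  using assms by (auto simp: crit_def pure_def)

lemma in_lattice_simps:
  "x \<in> L \<Longrightarrow> y \<in> L \<Longrightarrow> x + y \<in> L" "x \<in> L \<Longrightarrow> y \<in> L \<Longrightarrow> x - y \<in> L"
  "x \<in> L \<Longrightarrow> - x \<in> L" "x \<in> L \<Longrightarrow> frag_cmul n x \<in> L"
  using lattice_add lattice_diff lattice_uminus lattice_cmul lat by blast+

text \<open>A pure binomial \<open>mon a - mon b\<close> of the ideal has a pure exponent difference
  whose \<open>i\<close>-th coordinate is that of \<open>a\<close>, so minimality passes from
  vectors to binomials.\<close>

lemma critical_binomial:
  assumes w: "crit i w"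
  shows "critical (gideal (binom ` L) :: (3, 'k :: comm_ring_1) mpol set) i (binom w)"
  unfolding critical_def
proof (intro conjI exI allI impI)
  have p: "pure i w"
    using w by (simp add: crit_def)
  then show "binom w \<in> gideal (binom ` L)"
    by (auto simp: pure_def intro: gideal_base)
  show "binom w = mon (pos_part w) - mon (neg_part w)"
    by (rule binom_def)
  have "Poly_Mapping.keys (pos_part w) = {i}"
    using p by (force simp: in_keys_iff pure_def)
  moreover have "i \<notin> Poly_Mapping.keys (neg_part w)"
    using p by (auto simp: in_keys_iff pure_def)
  moreover have "neg_part w \<noteq> 0"
  proof
    assume "neg_part w = 0"
    then have "0 \<le> w !! l" for l
      using neg_part_lookup[of w l] by simp
    with nonneg[of w] p show False
      by (auto simp: pure_def)
  qed
  ultimately show "pure_exponents i (pos_part w) (neg_part w)"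
    by (auto simp: pure_exponents_def)
  fix a b assume ab: "pure_exponents i a b \<and> mon a - mon b \<in> (gideal (binom ` L) :: (3, 'k) mpol set)"
  let ?v = "int_vec a - int_vec b"
  have a: "Poly_Mapping.keys a = {i}" and b: "i \<notin> Poly_Mapping.keys b"
    using ab by (auto simp: pure_exponents_def)
  have "?v \<in> L"
    using ab binomial_in_lattice_ideal[OF lat, of a b, where 'k = 'k] by simp
  moreover have "Poly_Mapping.lookup a l = 0" if "l \<noteq> i" for l
    using a that by (auto simp: not_in_keys_iff_lookup_eq_zero[symmetric])
  moreover have "Poly_Mapping.lookup b i = 0" "Poly_Mapping.lookup a i \<noteq> 0"
    using a b by (auto simp: in_keys_iff set_eq_iff)
  ultimately have "pure i ?v" "?v !! i = int (Poly_Mapping.lookup a i)"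
    by (auto simp: pure_def lookup_minus)
  with w show "Poly_Mapping.lookup (pos_part w) i \<le> Poly_Mapping.lookup a i"
    unfolding crit_def by fastforce
qed

end

text \<open>The indices are parameters so that an argument given for one role of \<open>i\<close>,
  \<open>j\<close> and \<open>k\<close> transfers by interpretation with permuted indices.\<close>

locale indexed_lattice = graded_lattice +
  fixes i j k :: 3
  assumes ijk: "i \<noteq> j" "k \<noteq> i" "k \<noteq> j"
begin

lemma all_indices: "UNIV = {i, j, k}"
proof -
  obtain l where "l \<noteq> i" "l \<noteq> j" "UNIV = {i, j, l}"
    using third_index[OF ijk(1)] .
  with ijk UNIV_I[of k] show ?thesis by auto
qed

lemma all_index_iff: "(\<forall>l. P l) \<longleftrightarrow> P i \<and> P j \<and> P k"
  using all_indices by (metis UNIV_I insertE singletonD)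

lemma pure_iff: "pure l w \<longleftrightarrow> w \<in> L \<and> 0 < w !! l \<and>
    (i \<noteq> l \<longrightarrow> w !! i \<le> 0) \<and> (j \<noteq> l \<longrightarrow> w !! j \<le> 0) \<and> (k \<noteq> l \<longrightarrow> w !! k \<le> 0)"
  unfolding pure_def by (simp add: all_index_iff)

lemma nonpos_coords:
  assumes "w \<in> L" "w !! i \<le> 0" "w !! j \<le> 0" "w !! k \<le> 0"
  shows "w !! i = 0 \<and> w !! j = 0 \<and> w !! k = 0"
proof -
  have "\<forall>l. w !! l \<le> 0"
    unfolding all_index_iff using assms by simp
  with nonpos[OF assms(1)] have "w = 0" by blast
  then show ?thesis by simp
qed

lemma crit_le: "crit l w \<Longrightarrow> pure l v \<Longrightarrow> w !! l \<le> v !! l"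
  by (simp add: crit_def)

lemma critI: "pure l v \<Longrightarrow> crit l w \<Longrightarrow> v !! l = w !! l \<Longrightarrow> crit l v"
  by (simp add: crit_def)

lemma binomial_pure:
  assumes w: "pure i w"
  shows "pos_part w = Poly_Mapping.single i (nat (w !! i))"
    and "neg_part w = Poly_Mapping.single j (nat (- w !! j)) + Poly_Mapping.single k (nat (- w !! k))"
    and "binom w = indet i ^ nat (w !! i) - indet j ^ nat (- w !! j) * indet k ^ nat (- w !! k)"
proof -
  show *: "pos_part w = Poly_Mapping.single i (nat (w !! i))"
    using w by (intro poly_mapping_eqI) (auto simp: lookup_single when_def pure_def)
  show **: "neg_part w = Poly_Mapping.single j (nat (- w !! j)) + Poly_Mapping.single k (nat (- w !! k))"
  proof (rule poly_mapping_eqI)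
    fix l
    consider "l = i" | "l = j" | "l = k"
      using UNIV_I[of l] unfolding all_indices by auto
    then show "Poly_Mapping.lookup (neg_part w) l =
        Poly_Mapping.lookup (Poly_Mapping.single j (nat (- w !! j)) + Poly_Mapping.single k (nat (- w !! k))) l"
      by cases (use w ijk in \<open>auto simp: lookup_add lookup_single when_def pure_def\<close>)
  qed
  show "binom w = indet i ^ nat (w !! i) - indet j ^ nat (- w !! j) * indet k ^ nat (- w !! k)"
    unfolding binom_def * ** indet_power mon_mult ..
qed

section \<open>Two critical generators\<close>

text \<open>The vector \<open>- \<alpha>\<close> is pure for \<open>k\<close>. If it is not
  critical, \<open>\<gamma> !! i = 0\<close> and \<open>- \<gamma>\<close> is pure for
  \<open>j\<close>; if that is not critical either, \<open>- \<beta>\<close> is pure for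
  \<open>i\<close>, and going once around ends in a contradiction.\<close>

lemma opposite_critical_pair:
  assumes \<alpha>: "crit i \<alpha>" and \<beta>: "crit j \<beta>" and \<gamma>: "crit k \<gamma>" and "\<alpha> !! j = 0"
  shows "\<exists>p q \<delta>. p \<noteq> q \<and> crit p \<delta> \<and> crit q (- \<delta>)"
proof -
  note \<alpha>D = critD[OF \<alpha>] and \<beta>D = critD[OF \<beta>] and \<gamma>D = critD[OF \<gamma>]
  have "\<alpha> !! k < 0"
    using nonpos_coords[of "- \<alpha>"] \<alpha>D ijk \<open>\<alpha> !! j = 0\<close> by (force simp: in_lattice_simps)
  then have pk: "pure k (- \<alpha>)"
    using \<alpha>D ijk \<open>\<alpha> !! j = 0\<close> by (simp add: pure_iff in_lattice_simps)
  show ?thesis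
  proof (cases "\<gamma> !! k = - \<alpha> !! k")
    case True
    then show ?thesis
      using critI[OF pk \<gamma>] \<alpha> ijk(2) by (metis lookup_uminus)
  next
    case False
    then have ck: "\<gamma> !! k < - \<alpha> !! k"
      using crit_le[OF \<gamma> pk] by simp
    have \<alpha>\<gamma>: "\<alpha> + \<gamma> \<in> L"
      using \<alpha>D \<gamma>D by (simp add: in_lattice_simps)
    have \<gamma>j: "\<gamma> !! j \<le> 0" "\<gamma> !! i \<le> 0"
      using \<gamma>D ijk by auto
    \<comment> \<open>Coordinate \<open>k\<close> of the sum is negative and coordinate
      \<open>j\<close> nonpositive, so the sum is pure for \<open>i\<close>; minimality of
      \<open>\<alpha>\<close> then yields \<open>\<gamma> !! i = 0\<close>.\<close>
    have "0 < (\<alpha> + \<gamma>) !! i"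
      using nonpos_coords[OF \<alpha>\<gamma>] \<gamma>j \<open>\<alpha> !! j = 0\<close> ck by (force simp: lookup_add)
    then have "pure i (\<alpha> + \<gamma>)"
      using \<alpha>\<gamma> \<gamma>j \<open>\<alpha> !! j = 0\<close> ck ijk by (simp add: pure_iff lookup_add)
    from crit_le[OF \<alpha> this] have \<gamma>i: "\<gamma> !! i = 0"
      using \<gamma>j by (simp add: lookup_add)
    have "\<gamma> !! j < 0"
      using nonpos_coords[of "- \<gamma>"] \<gamma>D ijk \<gamma>i by (force simp: in_lattice_simps)
    then have pj: "pure j (- \<gamma>)"
      using \<gamma>D ijk \<gamma>i by (simp add: pure_iff in_lattice_simps)
    show ?thesis
    proof (cases "\<beta> !! j = - \<gamma> !! j")
      case True
      then show ?thesis
        using critI[OF pj \<beta>] \<gamma> ijk(3) by (metis lookup_uminus)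
    next
      case False
      then have cj: "\<beta> !! j < - \<gamma> !! j"
        using crit_le[OF \<beta> pj] by simp
      have \<beta>\<gamma>: "\<beta> + \<gamma> \<in> L"
        using \<beta>D \<gamma>D by (simp add: in_lattice_simps)
      have \<beta>i: "\<beta> !! i \<le> 0" "\<beta> !! k \<le> 0"
        using \<beta>D ijk by auto
      have "0 < (\<beta> + \<gamma>) !! k"
        using nonpos_coords[OF \<beta>\<gamma>] \<beta>i \<gamma>i cj by (force simp: lookup_add)
      then have "pure k (\<beta> + \<gamma>)"
        using \<beta>\<gamma> \<beta>i \<gamma>i cj ijk by (simp add: pure_iff lookup_add)
      from crit_le[OF \<gamma> this] have \<beta>k: "\<beta> !! k = 0"
        using \<beta>i by (simp add: lookup_add)
      have "\<beta> !! i < 0"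
        using nonpos_coords[of "- \<beta>"] \<beta>D ijk \<beta>k by (force simp: in_lattice_simps)
      then have "pure i (- \<beta>)"
        using \<beta>D ijk \<beta>k by (simp add: pure_iff in_lattice_simps)
      from crit_le[OF \<alpha> this] have "\<alpha> !! i \<le> - \<beta> !! i"
        by simp
      \<comment> \<open>All coordinates of the sum are nonpositive, and those at \<open>j\<close>
        and \<open>k\<close> are negative, which the grading forbids.\<close>
      then have False
        using nonpos_coords[of "\<alpha> + \<beta> + \<gamma>"] \<alpha>D \<beta>D \<gamma>D \<open>\<alpha> !! j = 0\<close> \<gamma>i \<beta>k ck cj
        by (simp add: in_lattice_simps lookup_add)
      then show ?thesis ..
    qed
  qed
qed

text \<open>Division by \<open>\<beta>\<close> in coordinate \<open>j\<close> is not disturbed by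
  the later division by \<open>\<delta>\<close> in coordinate \<open>i\<close>, since
  \<open>\<delta> !! j = 0\<close>. The remainder \<open>u\<close> is too small for \<open>u\<close>
  to be pure for \<open>j\<close> or \<open>- u\<close> for \<open>i\<close>, and the signs leave
  only \<open>u = 0\<close>.\<close>

lemma lattice_decomposition:
  assumes \<delta>: "crit i \<delta>" "crit k (- \<delta>)" and \<beta>: "crit j \<beta>" and w: "w \<in> L"
  obtains m n where "w = frag_cmul m \<delta> + frag_cmul n \<beta>"
proof -
  note \<delta>D = critD[OF \<delta>(1)] critD[OF \<delta>(2)] and \<beta>D = critD[OF \<beta>]
  have \<delta>j: "\<delta> !! j = 0"
    using critD(3)[OF \<delta>(1), of j] critD(3)[OF \<delta>(2), of j] ijk by simp
  define n where "n = w !! j div \<beta> !! j"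
  define v where "v = w - frag_cmul n \<beta>"
  \<comment> \<open>Dividing the negated coordinate makes \<open>u !! i\<close> nonpositive, so that
    \<open>- u\<close> is the candidate for purity at \<open>i\<close>.\<close>
  define m where "m = (- v !! i) div \<delta> !! i"
  define u where "u = v + frag_cmul m \<delta>"
  have "v \<in> L" "u \<in> L"
    using w \<delta>D \<beta>D by (auto simp: v_def u_def in_lattice_simps)
  have uj: "u !! j = w !! j mod \<beta> !! j"
    by (simp add: u_def v_def n_def lookup_add lookup_minus \<delta>j minus_div_mult_eq_mod)
  then have j: "0 \<le> u !! j" "u !! j < \<beta> !! j"
    using \<beta>D by simp_all
  have ui: "u !! i = - ((- v !! i) mod \<delta> !! i)"
    using minus_div_mult_eq_mod[of "- v !! i" "\<delta> !! i"] by (simp add: u_def m_def lookup_add)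
  then have i: "u !! i \<le> 0" "- u !! i < \<delta> !! i"
    using \<delta>D by simp_all
  have not_pure_j: "\<not> pure j u"
    using crit_le[OF \<beta>, of u] j by auto
  have not_pure_i: "\<not> pure i (- u)"
    using crit_le[OF \<delta>(1), of "- u"] i by auto
  have "u = 0"
  proof (cases "u !! j = 0")
    case True
    have "0 \<le> u !! k \<or> u !! i = 0 \<and> u !! k = 0"
      using nonpos_coords[of u] i True \<open>u \<in> L\<close> by force
    then have "u !! i = 0"
      using not_pure_i ijk True i \<open>u \<in> L\<close> by (auto simp: pure_iff in_lattice_simps)
    then have "u !! k = 0"
      using nonpos_coords[of u] nonpos_coords[of "- u"] True \<open>u \<in> L\<close> by (force simp: in_lattice_simps)
    with True \<open>u !! i = 0\<close> show "u = 0"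
      using all_index_iff[of "\<lambda>l. u !! l = 0"] by (auto intro: poly_mapping_eqI)
  next
    case False
    with j i have "0 < u !! k"
      using not_pure_j ijk \<open>u \<in> L\<close> by (force simp: pure_iff)
    moreover from this have "u !! i < 0"
      using nonpos_coords[of "- u"] i j \<open>u \<in> L\<close> by (force simp: in_lattice_simps)
    ultimately have "pure i (- u)"
      using j ijk \<open>u \<in> L\<close> by (simp add: pure_iff in_lattice_simps)
    with not_pure_i show ?thesis ..
  qed
  then have "w = frag_cmul (- m) \<delta> + frag_cmul n \<beta>"
    by (simp add: u_def v_def algebra_simps flip: minus_frag_cmul)
  then show thesis ..
qed

text \<open>The two monomials of \<open>binom w\<close> are joined by a multiple of
  \<open>\<beta>\<close> followed by a multiple of \<open>\<delta>\<close>; when the coefficient of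
  \<open>\<beta>\<close> is negative, \<open>- w\<close> is used instead.\<close>

lemma gideal_two_binomials:
  assumes \<delta>: "crit i \<delta>" "crit k (- \<delta>)" and \<beta>: "crit j \<beta>"
  shows "gideal {binom \<delta>, binom \<beta>} = (gideal (binom ` L) :: (3, 'k :: comm_ring_1) mpol set)"
    (is "?J = ?I")
proof (rule antisym)
  show "?J \<subseteq> ?I"
    using \<delta> \<beta> by (intro gideal_mono) (auto dest: critD)
  have \<delta>j: "\<delta> !! j = 0"
    using critD(3)[OF \<delta>(1), of j] critD(3)[OF \<delta>(2), of j] ijk by simp
  have sub: "gideal {binom \<delta>} \<subseteq> ?J" "gideal {binom \<beta>} \<subseteq> ?J"
    by (intro gideal_mono; simp)+
  have nonneg_case: "binom w \<in> ?J" if w: "w = frag_cmul m \<delta> + frag_cmul n \<beta>" and n: "0 \<le> n" for w m n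
  proof -
    \<comment> \<open>The intermediate exponent is nonnegative: \<open>n \<beta>\<close> is
      nonpositive in coordinates \<open>i\<close> and \<open>k\<close>, and in coordinate
      \<open>j\<close> it agrees with \<open>w\<close>.\<close>
    define x where "x = int_vec (pos_part w) - frag_cmul n \<beta>"
    have "n * \<beta> !! i \<le> 0" "n * \<beta> !! k \<le> 0"
      using critD(3)[OF \<beta>] ijk n by (simp_all add: mult_nonneg_nonpos)
    moreover have "x !! j \<ge> 0"
      by (simp add: x_def lookup_minus w lookup_add \<delta>j)
    ultimately have "\<forall>l. 0 \<le> x !! l"
      unfolding all_index_iff by (simp add: x_def lookup_minus)
    then have x: "int_vec (pos_part x) = x"
      by (intro poly_mapping_eqI) simp
    have "mon (pos_part w) - mon (pos_part x) \<in> ?J"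
      using sub by (intro subsetD[OF sub(2)] mon_diff_in_multiples[of _ _ n])
        (unfold x, simp add: x_def)
    moreover have "x - int_vec (neg_part w) = frag_cmul m \<delta>"
      using pos_part_minus_neg_part[of w] by (simp add: x_def w algebra_simps)
    then have "mon (pos_part x) - mon (neg_part w) \<in> ?J"
      using sub by (intro subsetD[OF sub(1)] mon_diff_in_multiples[of _ _ m]) (simp add: x)
    ultimately have "(mon (pos_part w) - mon (pos_part x)) + (mon (pos_part x) - mon (neg_part w)) \<in> ?J"
      by (rule gideal_add)
    then show ?thesis
      by (simp add: binom_def)
  qed
  have "binom w \<in> ?J" if "w \<in> L" for w
  proof -
    from \<delta> \<beta> \<open>w \<in> L\<close> obtain m n where w: "w = frag_cmul m \<delta> + frag_cmul n \<beta>"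
      by (rule lattice_decomposition)
    show ?thesis
    proof (cases "0 \<le> n")
      case False
      have "- w = frag_cmul (- m) \<delta> + frag_cmul (- n) \<beta>"
        by (simp add: w flip: minus_frag_cmul)
      with False have "binom (- w) \<in> ?J"
        by (intro nonneg_case[of _ "- m" "- n"]) simp_all
      then show ?thesis
        using gideal_uminus by (fastforce simp: binom_uminus)
    qed (rule nonneg_case[OF w])
  qed
  then show "?I \<subseteq> ?J"
    by (intro gideal_subset_gideal) auto
qed

text \<open>Membership would make the nonzero \<open>v\<close> a multiple of \<open>w\<close>,
  although exactly one of the two has zero \<open>j\<close>-th coordinate.\<close>

lemma binom_notin_multiples:
  assumes "v \<noteq> 0" "v !! j = 0 \<longleftrightarrow> w !! j \<noteq> 0"
  shows "binom v \<notin> (gideal {binom w} :: (3, 'k :: comm_ring_1) mpol set)"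
proof
  let ?M = "range (\<lambda>n. frag_cmul n w)"
  assume v: "binom v \<in> (gideal {binom w} :: (3, 'k) mpol set)"
  have M: "lattice ?M"
    unfolding lattice_iff
  proof (intro conjI ballI)
    show "0 \<in> ?M"
      by (rule range_eqI[of _ _ 0]) simp
    fix x assume x: "x \<in> ?M"
    then show "- x \<in> ?M"
      by auto
    fix y assume "y \<in> ?M"
    with x show "x + y \<in> ?M"
      by (auto simp flip: frag_cmul_distrib)
  qed
  have "w \<in> ?M"
    by (rule range_eqI[of _ _ 1]) simp
  then have "gideal {binom w} \<subseteq> (gideal (binom ` ?M) :: (3, 'k) mpol set)"
    by (intro gideal_mono) simp
  with v have "mon (pos_part v) - mon (neg_part v) \<in> (gideal (binom ` ?M) :: (3, 'k) mpol set)"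
    unfolding binom_def[of v] by blast
  then have "v \<in> ?M"
    unfolding binomial_in_lattice_ideal[OF M] pos_part_minus_neg_part .
  then obtain n where "v = frag_cmul n w"
    by blast
  with assms show False
    by auto
qed

lemma minimally_generated_two:
  assumes \<delta>: "crit i \<delta>" "crit k (- \<delta>)" and \<beta>: "crit j \<beta>"
  shows "minimally_generated mpol_ring (gideal (binom ` L) :: (3, 'k :: comm_ring_1) mpol set)
    {binom \<delta>, binom \<beta>}"
proof (rule minimally_generatedI)
  have \<delta>j: "\<delta> !! j = 0"
    using critD(3)[OF \<delta>(1), of j] critD(3)[OF \<delta>(2), of j] ijk by simp
  have ne: "\<delta> \<noteq> 0" "\<beta> \<noteq> 0" "\<beta> !! j \<noteq> 0"
    using critD(2)[OF \<delta>(1)] critD(2)[OF \<beta>] by auto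
  have "binom \<delta> \<notin> (gideal {binom \<beta>} :: (3, 'k) mpol set)" "binom \<beta> \<notin> (gideal {binom \<delta>} :: (3, 'k) mpol set)"
    using \<delta>j ne by (intro binom_notin_multiples; simp)+
  moreover fix x :: "(3, 'k) mpol" assume "x \<in> {binom \<delta>, binom \<beta>}"
  ultimately show "x \<notin> gideal ({binom \<delta>, binom \<beta>} - {x})"
    using gideal_mono[of "{binom \<delta>, binom \<beta>} - {binom \<delta>}" "{binom \<beta> :: (3, 'k) mpol}"]
      gideal_mono[of "{binom \<delta>, binom \<beta>} - {binom \<beta>}" "{binom \<delta> :: (3, 'k) mpol}"]
    by auto
qed (rule gideal_two_binomials[OF assms])

text \<open>Adding multiples of \<open>\<delta>\<close> preserves coordinate \<open>j\<close> and
  hence minimality. Reduction modulo \<open>\<delta> !! i\<close> gives \<open>b1 \<le> a1\<close>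
  in the two-generator case; the negative coordinate gives \<open>0 < b1 + b3\<close>.\<close>

lemma reduced_critical_vector:
  assumes \<delta>: "crit i \<delta>" "crit k (- \<delta>)" and \<beta>: "crit j \<beta>"
  obtains \<beta>' where "crit j \<beta>'" "- \<beta>' !! i \<le> \<delta> !! i" "\<beta>' !! i < 0 \<or> \<beta>' !! k < 0"
proof -
  note \<delta>D = critD[OF \<delta>(1)] critD[OF \<delta>(2)] and \<beta>D = critD[OF \<beta>]
  have \<delta>j: "\<delta> !! j = 0"
    using critD(3)[OF \<delta>(1), of j] critD(3)[OF \<delta>(2), of j] ijk by simp
  define n where "n = (- \<beta> !! i) div \<delta> !! i"
  define \<beta>' where "\<beta>' = \<beta> + frag_cmul n \<delta>"
  \<comment> \<open>A nonnegative multiple of \<open>\<delta>\<close> keeps coordinate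
    \<open>k\<close> nonpositive.\<close>
  have "0 \<le> n"
    unfolding n_def using \<delta>D(2) critD(3)[OF \<beta>, of i] ijk by (simp add: pos_imp_zdiv_nonneg_iff)
  then have "n * \<delta> !! k \<le> 0"
    using \<delta>D by (simp add: mult_nonneg_nonpos)
  then have k: "\<beta>' !! k \<le> 0"
    using critD(3)[OF \<beta>, of k] ijk by (simp add: \<beta>'_def lookup_add)
  have j: "\<beta>' !! j = \<beta> !! j"
    by (simp add: \<beta>'_def lookup_add \<delta>j)
  have "\<beta>' !! i = - ((- \<beta> !! i) mod \<delta> !! i)"
    using minus_div_mult_eq_mod[of "- \<beta> !! i" "\<delta> !! i"] by (simp add: \<beta>'_def n_def lookup_add)
  then have i: "\<beta>' !! i \<le> 0" "- \<beta>' !! i \<le> \<delta> !! i"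
    using \<delta>D less_imp_le[OF pos_mod_bound[OF \<delta>D(2), of "- \<beta> !! i"]] by simp_all
  have L: "\<beta>' \<in> L"
    using \<beta>D \<delta>D by (simp add: \<beta>'_def in_lattice_simps)
  have "pure j \<beta>'"
    using L i(1) j k \<beta>D by (simp add: pure_iff)
  then have crit: "crit j \<beta>'"
    using \<beta> j by (rule critI)
  have "\<beta>' !! i < 0 \<or> \<beta>' !! k < 0"
    using nonpos_coords[of "- \<beta>'"] L critD(2)[OF crit] by (force simp: in_lattice_simps)
  with crit i(2) show thesis
    by (rule that)
qed

section \<open>Three critical generators\<close>

text \<open>Coordinates \<open>j\<close> and \<open>k\<close> of the sum lie below the minimal ones,
  so the sum is pure neither for \<open>j\<close> nor for \<open>k\<close>. As its coordinate
  \<open>i\<close> is negative, a negative coordinate at \<open>j\<close> or \<open>k\<close> would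
  make it pure for the other one.\<close>

lemma pure_sum_of_critical:
  assumes \<beta>: "crit j \<beta>" "\<beta> !! i < 0" "\<beta> !! k < 0" and \<gamma>: "crit k \<gamma>" "\<gamma> !! i < 0" "\<gamma> !! j < 0"
  shows "pure i (- (\<beta> + \<gamma>))"
proof -
  have L: "\<beta> + \<gamma> \<in> L"
    using critD(1)[OF \<beta>(1)] critD(1)[OF \<gamma>(1)] by (rule in_lattice_simps)
  have "\<not> pure j (\<beta> + \<gamma>)" "\<not> pure k (\<beta> + \<gamma>)"
    using crit_le[OF \<beta>(1), of "\<beta> + \<gamma>"] crit_le[OF \<gamma>(1), of "\<beta> + \<gamma>"] \<beta> \<gamma>
    by (auto simp: lookup_add)
  then have "0 \<le> (\<beta> + \<gamma>) !! j" "0 \<le> (\<beta> + \<gamma>) !! k"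
    using L \<beta> \<gamma> ijk nonpos_coords[OF L] by (force simp: pure_iff lookup_add)+
  moreover have "- (\<beta> + \<gamma>) \<in> L"
    using L by (rule in_lattice_simps)
  ultimately show ?thesis
    using \<beta> \<gamma> ijk by (simp add: pure_iff lookup_add lookup_minus)
qed

end

context graded_lattice
begin

lemma indexed: "i \<noteq> j \<Longrightarrow> k \<noteq> i \<Longrightarrow> k \<noteq> j \<Longrightarrow> indexed_lattice L d i j k"
  by unfold_locales

text \<open>The negated sum of any two of the vectors is pure for the third index, so by minimality
  all coordinates of \<open>\<alpha> + \<beta> + \<gamma>\<close> are nonpositive, hence zero by the
  grading.\<close>

lemma critical_sum_zero:
  assumes ijk: "i \<noteq> j" "k \<noteq> i" "k \<noteq> j"
    and \<alpha>: "crit i \<alpha>" "\<alpha> !! j < 0" "\<alpha> !! k < 0"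
    and \<beta>: "crit j \<beta>" "\<beta> !! i < 0" "\<beta> !! k < 0"
    and \<gamma>: "crit k \<gamma>" "\<gamma> !! i < 0" "\<gamma> !! j < 0"
  shows "\<alpha> !! i = - \<beta> !! i - \<gamma> !! i" "\<beta> !! j = - \<alpha> !! j - \<gamma> !! j" "\<gamma> !! k = - \<alpha> !! k - \<beta> !! k"
proof -
  interpret ijk: indexed_lattice L d i j k using ijk by (intro indexed) auto
  interpret jik: indexed_lattice L d j i k using ijk by (intro indexed) auto
  interpret kij: indexed_lattice L d k i j using ijk by (intro indexed) auto
  have "\<alpha> !! i \<le> - \<beta> !! i - \<gamma> !! i"
    using ijk.crit_le[OF \<alpha>(1) ijk.pure_sum_of_critical[OF \<beta> \<gamma>]] by (simp add: lookup_add lookup_minus)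
  moreover have "\<beta> !! j \<le> - \<alpha> !! j - \<gamma> !! j"
    using ijk.crit_le[OF \<beta>(1) jik.pure_sum_of_critical[OF \<alpha> \<gamma>(1,3,2)]] by (simp add: lookup_add lookup_minus)
  moreover have "\<gamma> !! k \<le> - \<alpha> !! k - \<beta> !! k"
    using ijk.crit_le[OF \<gamma>(1) kij.pure_sum_of_critical[OF \<alpha>(1,3,2) \<beta>(1,3,2)]] by (simp add: lookup_add lookup_minus)
  moreover have "\<alpha> + \<beta> + \<gamma> \<in> L"
    using critD(1)[OF \<alpha>(1)] critD(1)[OF \<beta>(1)] critD(1)[OF \<gamma>(1)] by (simp add: in_lattice_simps)
  ultimately show "\<alpha> !! i = - \<beta> !! i - \<gamma> !! i" "\<beta> !! j = - \<alpha> !! j - \<gamma> !! j" "\<gamma> !! k = - \<alpha> !! k - \<beta> !! k"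
    using ijk.nonpos_coords[of "\<alpha> + \<beta> + \<gamma>"] by (auto simp: lookup_add)
qed

text \<open>Both signs occur in a nonzero vector of \<open>L\<close>, and among three coordinates
  one of the signs occurs only once.\<close>

lemma pure_or_opposite_pure:
  assumes "w \<in> L" "w \<noteq> 0"
  shows "\<exists>l. pure l w \<or> pure l (- w)"
proof -
  obtain i j k :: 3 where "i \<noteq> j" "k \<noteq> i" "k \<noteq> j"
    using other_indices by metis
  then interpret indexed_lattice L d i j k by (rule indexed)
  have "\<not> (\<forall>l. w !! l = 0)"
    using assms(2) by (auto intro: poly_mapping_eqI)
  then have ne: "\<not> (w !! i = 0 \<and> w !! j = 0 \<and> w !! k = 0)"
    by (simp add: all_index_iff)
  have "- w \<in> L"
    using assms(1) by (rule in_lattice_simps)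
  have "\<not> (w !! i \<le> 0 \<and> w !! j \<le> 0 \<and> w !! k \<le> 0)" "\<not> (0 \<le> w !! i \<and> 0 \<le> w !! j \<and> 0 \<le> w !! k)"
    using ne nonpos_coords[OF assms(1)] nonpos_coords[OF \<open>- w \<in> L\<close>] by auto
  then have "pure i w \<or> pure i (- w) \<or> pure j w \<or> pure j (- w) \<or> pure k w \<or> pure k (- w)"
    using assms(1) \<open>- w \<in> L\<close> ijk
    by (cases "0 < w !! i"; cases "0 < w !! j"; cases "0 < w !! k") (auto simp: pure_iff)
  then show ?thesis by blast
qed

text \<open>Induction on the degree: a critical binomial replaces one monomial by one that shares a
  variable with the other, and cancelling this variable lowers the degree.\<close>

lemma gideal_three_binomials:
  assumes \<epsilon>: "\<And>l. crit l (\<epsilon> l)" "\<And>l m. m \<noteq> l \<Longrightarrow> \<epsilon> l !! m < 0"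
  shows "gideal (range (\<lambda>l. binom (\<epsilon> l))) = (gideal (binom ` L) :: (3, 'k :: comm_ring_1) mpol set)"
    (is "?J = ?I")
proof (rule antisym)
  show "?J \<subseteq> ?I"
    using critD(1)[OF \<epsilon>(1)] by (intro gideal_mono) auto
  have wdeg_eq: "wdeg d a = wdeg d b" if "int_vec a - int_vec b \<in> L" for a b
    using orth[OF that] wdeg_diff[of d a b] by (simp add: orthogonal_def)
  have "mon a - mon b \<in> ?J" if "int_vec a - int_vec b \<in> L" for a b
    using that
  proof (induction "wdeg d a" arbitrary: a b rule: less_induct)
    case less
    have common: "mon x - mon y \<in> ?J"
      if xy: "wdeg d x = wdeg d a" "int_vec x - int_vec y \<in> L"
        and l: "0 < Poly_Mapping.lookup x l" "0 < Poly_Mapping.lookup y l" for x y l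
    proof -
      define e where "e = Poly_Mapping.single l (1 :: nat)"
      have x: "e + (x - e) = x" and y: "e + (y - e) = y"
        using l by (auto intro!: poly_mapping_eqI simp: lookup_add lookup_minus lookup_single when_def e_def)
      have "0 < wdeg d e"
        unfolding wdeg_def e_def using d_pos[of l] by (intro sum_pos2[of _ l]) auto
      then have "wdeg d (x - e) < wdeg d a"
        using wdeg_add[of d e "x - e"] xy(1) by (simp add: x)
      moreover have "int_vec (x - e) - int_vec (y - e) = int_vec x - int_vec y"
        using int_vec_add[of e "x - e"] int_vec_add[of e "y - e"] by (simp add: x y)
      ultimately have "mon (x - e) - mon (y - e) \<in> ?J"
        using xy(2) by (intro less.hyps) simp_all
      then have "mon e * (mon (x - e) - mon (y - e)) \<in> ?J"
        by (rule gideal_mult)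
      then show ?thesis
        by (simp add: right_diff_distrib mon_mult x y)
    qed
    have pure_case: "mon x - mon y \<in> ?J"
      if xy: "wdeg d x = wdeg d a" and p: "pure l (int_vec x - int_vec y)" for x y l
    proof -
      let ?w = "int_vec x - int_vec y"
      \<comment> \<open>The exponent after one use of the critical binomial: nonnegative at
        \<open>l\<close> because \<open>\<epsilon> l !! l \<le> ?w !! l\<close>, and positive at all
        other indices.\<close>
      define z where "z = int_vec x - \<epsilon> l"
      have w: "?w \<in> L" "\<epsilon> l !! l \<le> ?w !! l"
        using p \<epsilon>(1)[of l] by (auto simp: pure_def crit_def)
      have "0 \<le> z !! m" for m
        using w(2) \<epsilon>(2)[of m l] by (cases "m = l") (auto simp: z_def lookup_minus intro: order_trans)
      then have z: "int_vec (pos_part z) = z"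
        by (intro poly_mapping_eqI) simp
      have xz: "int_vec x - int_vec (pos_part z) = \<epsilon> l"
        by (simp add: z) (simp add: z_def)
      then have "mon x - mon (pos_part z) \<in> gideal {binom (\<epsilon> l)}"
        by (intro mon_diff_in_multiples[of _ _ 1]) simp
      then have 1: "mon x - mon (pos_part z) \<in> ?J"
        using gideal_mono[of "{binom (\<epsilon> l)}" "range (\<lambda>l. binom (\<epsilon> l))"] by blast
      \<comment> \<open>By the grading \<open>y\<close> exceeds \<open>x\<close> at some
        \<open>m \<noteq> l\<close>, so the variable \<open>m\<close> divides both the new monomial
        and \<open>mon y\<close>.\<close>
      have "\<exists>m. m \<noteq> l \<and> ?w !! m < 0"
      proof (rule ccontr)
        assume "\<not> ?thesis"
        then have "0 \<le> ?w !! m" for m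
          using p by (cases "m = l") (auto simp: pure_def not_less)
        from nonneg[OF w(1) this] p show False
          by (simp add: pure_def)
      qed
      then obtain m where m: "m \<noteq> l" "?w !! m < 0" by blast
      have "0 < Poly_Mapping.lookup y m"
        using m(2) by (simp add: lookup_minus)
      moreover have "0 < Poly_Mapping.lookup (pos_part z) m"
        using \<epsilon>(2)[OF m(1)] by (simp add: z_def lookup_minus)
      moreover have "wdeg d (pos_part z) = wdeg d a"
        using wdeg_eq[of x "pos_part z"] xz critD(1)[OF \<epsilon>(1)] xy by simp
      moreover have eq: "int_vec (pos_part z) - int_vec y = ?w - \<epsilon> l"
        by (simp add: z) (simp add: z_def)
      have "int_vec (pos_part z) - int_vec y \<in> L"
        unfolding eq using w(1) critD(1)[OF \<epsilon>(1)] by (rule in_lattice_simps)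
      ultimately have "mon (pos_part z) - mon y \<in> ?J"
        by (intro common)
      from gideal_add[OF 1 this] show ?thesis
        by simp
    qed
    show ?case
    proof (cases "int_vec a - int_vec b = 0")
      case True
      then have "a = b"
        by (intro poly_mapping_eqI) (metis int_vec_lookup eq_iff_diff_eq_0 of_nat_eq_iff)
      then show ?thesis
        by (simp add: gideal_zero)
    next
      case False
      then obtain l where "pure l (int_vec a - int_vec b) \<or> pure l (- (int_vec a - int_vec b))"
        using pure_or_opposite_pure[OF less.prems] by blast
      then show ?thesis
      proof
        assume "pure l (- (int_vec a - int_vec b))"
        then have "mon b - mon a \<in> ?J"
          using wdeg_eq[OF less.prems] by (intro pure_case[of b l a]) simp_all
        then show ?thesis
          using gideal_uminus by fastforce
      qed (rule pure_case[OF refl])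
    qed
  qed
  then have "binom w \<in> ?J" if "w \<in> L" for w
    using that by (simp add: binom_def pos_part_minus_neg_part)
  then show "?I \<subseteq> ?J"
    by (intro gideal_subset_gideal) auto
qed

lemma minimally_generated_three:
  assumes \<epsilon>: "\<And>l. crit l (\<epsilon> l)" "\<And>l m. m \<noteq> l \<Longrightarrow> \<epsilon> l !! m < 0"
  shows "minimally_generated mpol_ring (gideal (binom ` L) :: (3, 'k :: comm_ring_1) mpol set)
    (range (\<lambda>l. binom (\<epsilon> l)))"
proof (rule minimally_generatedI)
  show "gideal (range (\<lambda>l. binom (\<epsilon> l))) = (gideal (binom ` L) :: (3, 'k) mpol set)"
    using \<epsilon> by (rule gideal_three_binomials)
  fix x :: "(3, 'k) mpol" assume "x \<in> range (\<lambda>l. binom (\<epsilon> l))"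
  then obtain l where x: "x = binom (\<epsilon> l)" by blast
  \<comment> \<open>The exponents involving a variable other than \<open>l\<close>: both monomials
    of each other generator are of this kind, the power of \<open>indet l\<close> is not.\<close>
  define U where "U = {a :: 3 \<Rightarrow>\<^sub>0 nat. \<exists>m. m \<noteq> l \<and> 0 < Poly_Mapping.lookup a m}"
  have \<epsilon>_pos: "0 < \<epsilon> m !! m" for m
    using critD(2)[OF \<epsilon>(1)] .
  have "x \<notin> gideal (binom ` (\<epsilon> ` (UNIV - {l})))"
    unfolding x
  proof (rule binomial_notin_gideal)
    show "c + a \<in> U" if "a \<in> U" for a c
      using that by (auto simp: U_def lookup_add)
    show "pos_part w \<in> U \<and> neg_part w \<in> U" if w: "w \<in> \<epsilon> ` (UNIV - {l})" for w
    proof -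
      obtain m where m: "m \<noteq> l" "w = \<epsilon> m"
        using w by auto
      obtain n where "n \<noteq> l" "n \<noteq> m"
        using third_index[OF m(1)] by metis
      then show ?thesis
        using m \<epsilon>_pos[of m] \<epsilon>(2)[of n m] by (auto simp: U_def)
    qed
    show "\<epsilon> l \<noteq> 0"
      using \<epsilon>_pos[of l] by auto
    show "pos_part (\<epsilon> l) \<notin> U"
      using critD(3)[OF \<epsilon>(1)] by (fastforce simp: U_def)
  qed
  moreover have "gideal (range (\<lambda>l. binom (\<epsilon> l)) - {x}) \<subseteq> gideal (binom ` (\<epsilon> ` (UNIV - {l})) :: (3, 'k) mpol set)"
    by (intro gideal_mono) (auto simp: x)
  ultimately show "x \<notin> gideal (range (\<lambda>l. binom (\<epsilon> l)) - {x})"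
    by blast
qed

end

section \<open>Renumbering and the two cases\<close>

lemma index_permutation:
  fixes i j k :: 3
  assumes "i \<noteq> j" "k \<noteq> i" "k \<noteq> j"
  obtains \<pi> :: "3 \<Rightarrow> 3" where "bij \<pi>" "\<pi> 1 = i" "\<pi> 2 = j" "\<pi> 3 = k"
proof -
  define \<pi> where "\<pi> x = (if x = 1 then i else if x = 2 then j else k)" for x :: 3
  have \<pi>: "\<pi> 1 = i" "\<pi> 2 = j" "\<pi> 3 = k"
    by (simp_all add: \<pi>_def)
  obtain l where "l \<noteq> i" "l \<noteq> j" "UNIV = {i, j, l}"
    using third_index[OF assms(1)] .
  then have "UNIV = {i, j, k}"
    using assms UNIV_I[of k] by auto
  then have "surj \<pi>"
    using \<pi> by (metis (no_types, lifting) UNIV_eq_I insertE rangeI singletonD)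
  then have "bij \<pi>"
    by (simp add: bij_def finite_UNIV_surj_inj)
  with \<pi> that show thesis by blast
qed

theorem theorem8p2:
  fixes I :: "(3, 'k :: field) mpol set"
  assumes "lattice_ideal I"
    and "homogeneous_ideal I"
    and "height mpol_ring I = 2"
  shows "\<exists>f :: 3 \<Rightarrow> (3, 'k) mpol.
    full_set_of_critical_binomials I f \<and> I = genideal mpol_ring (range f) \<and>
    (\<exists>\<pi> :: 3 \<Rightarrow> 3. bij \<pi> \<and>
      ((\<exists>a1 b1 b2 b3 c3 :: nat.
          f (\<pi> 1) = indet (\<pi> 1) ^ a1 - indet (\<pi> 3) ^ c3 \<and>
          f (\<pi> 2) = indet (\<pi> 2) ^ b2 - indet (\<pi> 1) ^ b1 * indet (\<pi> 3) ^ b3 \<and>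
          f (\<pi> 3) = - f (\<pi> 1) \<and>
          minimally_generated mpol_ring I {f (\<pi> 1), f (\<pi> 2)} \<and>
          0 \<le> b1 \<and> b1 \<le> a1 \<and> 0 < a1 \<and> 0 < b2 \<and> 0 < c3 \<and> 0 < b1 + b3)
       \<or>
       (\<exists>a1 a2 a3 b1 b2 b3 c1 c2 c3 :: nat.
          f (\<pi> 1) = indet (\<pi> 1) ^ a1 - indet (\<pi> 2) ^ a2 * indet (\<pi> 3) ^ a3 \<and>
          f (\<pi> 2) = indet (\<pi> 2) ^ b2 - indet (\<pi> 1) ^ b1 * indet (\<pi> 3) ^ b3 \<and>
          f (\<pi> 3) = indet (\<pi> 3) ^ c3 - indet (\<pi> 1) ^ c1 * indet (\<pi> 2) ^ c2 \<and>
          minimally_generated mpol_ring I {f (\<pi> 1), f (\<pi> 2), f (\<pi> 3)} \<and>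
          0 < a2 \<and> a2 < b2 \<and> 0 < a3 \<and> a3 < c3 \<and>
          0 < b1 \<and> b1 < a1 \<and> 0 < b3 \<and> b3 < c3 \<and>
          0 < c1 \<and> c1 < a1 \<and> 0 < c2 \<and> c2 < b2 \<and>
          a1 = b1 + c1 \<and> b2 = a2 + c2 \<and> c3 = a3 + b3)))"
proof -
  obtain L where lat: "lattice L" and "I = gideal {mon (pos_part a) - mon (neg_part a) | a. a \<in> L}"
    using assms(1) unfolding lattice_ideal_def by blast
  then have I: "I = gideal (binom ` L)"
    by (simp add: binom_def image_def Setcompr_eq_image)
  obtain d where d: "\<And>i. 0 < d i" "homogeneous_wrt d I"
    using assms(2) unfolding homogeneous_ideal_def by blast
  interpret graded_lattice L d
  proof (rule graded_lattice.intro)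
    show "orthogonal d w" if "w \<in> L" for w
      using homogeneous_lattice_ideal[OF lat _ that, of d] d(2) unfolding I orthogonal_def by blast
  qed (rule lat d)+
  have "\<exists>w. crit l w" for l
    using pure_exists assms(3) unfolding I by (intro crit_exists) blast
  then obtain \<epsilon> where \<epsilon>: "\<And>l. crit l (\<epsilon> l)"
    by metis
  have critical: "critical I l (binom w)" if "crit l w" for l w
    unfolding I using that by (rule critical_binomial)
  show ?thesis
  \<comment> \<open>Negative coordinates off the diagonal give three generators, with the identity
    as renumbering; a zero coordinate leads to two generators.\<close>
  proof (cases "\<forall>l m. m \<noteq> l \<longrightarrow> \<epsilon> l !! m < 0")
    case True
    then have neg: "\<epsilon> l !! m < 0" if "m \<noteq> l" for l m
      using that by blast
    interpret p1: indexed_lattice L d 1 2 3 by (intro indexed) simp_all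
    interpret p2: indexed_lattice L d 2 1 3 by (intro indexed) simp_all
    interpret p3: indexed_lattice L d 3 1 2 by (intro indexed) simp_all
    define f :: "3 \<Rightarrow> (3, 'k) mpol" where "f l = binom (\<epsilon> l)" for l
    have pure: "pure l (\<epsilon> l)" for l
      using \<epsilon>[of l] by (simp add: crit_def)
    have range: "range f = {f 1, f 2, f 3}"
      using p1.all_indices by (metis image_empty image_insert)
    have gen: "gideal (range f) = I"
      unfolding f_def I using \<epsilon> neg by (rule gideal_three_binomials)
    have min: "minimally_generated mpol_ring I {f 1, f 2, f 3}"
      unfolding range[symmetric] unfolding f_def I using \<epsilon> neg by (rule minimally_generated_three)
    \<comment> \<open>Up to signs these are \<open>a1 = b1 + c1\<close>, \<open>b2 = a2 + c2\<close>
      and \<open>c3 = a3 + b3\<close>, which also give the strict upper bounds.\<close>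
    have sums: "\<epsilon> 1 !! 1 = - \<epsilon> 2 !! 1 - \<epsilon> 3 !! 1" "\<epsilon> 2 !! 2 = - \<epsilon> 1 !! 2 - \<epsilon> 3 !! 2"
      "\<epsilon> 3 !! 3 = - \<epsilon> 1 !! 3 - \<epsilon> 2 !! 3"
      by (rule critical_sum_zero[OF _ _ _ \<epsilon> _ _ \<epsilon> _ _ \<epsilon>]; use neg in simp)+
    have lt: "\<epsilon> 1 !! 2 < 0" "\<epsilon> 1 !! 3 < 0" "\<epsilon> 2 !! 1 < 0" "\<epsilon> 2 !! 3 < 0" "\<epsilon> 3 !! 1 < 0" "\<epsilon> 3 !! 2 < 0"
      using neg by simp_all
    show ?thesis
    proof (rule exI[of _ f], intro conjI, goal_cases)
      case 1
      show ?case
        using critical[OF \<epsilon>] by (simp add: full_set_of_critical_binomials_def f_def)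
    next
      case 2
      show ?case
        using gen by simp
    next
      case 3
      show ?case
        by (rule exI[of _ id], intro conjI disjI2, rule bij_id, unfold id_apply,
          rule exI[of _ "nat (\<epsilon> 1 !! 1)"],
          rule exI[of _ "nat (- \<epsilon> 1 !! 2)"],
          rule exI[of _ "nat (- \<epsilon> 1 !! 3)"],
          rule exI[of _ "nat (- \<epsilon> 2 !! 1)"],
          rule exI[of _ "nat (\<epsilon> 2 !! 2)"],
          rule exI[of _ "nat (- \<epsilon> 2 !! 3)"],
          rule exI[of _ "nat (- \<epsilon> 3 !! 1)"],
          rule exI[of _ "nat (- \<epsilon> 3 !! 2)"],
          rule exI[of _ "nat (\<epsilon> 3 !! 3)"], intro conjI)
          (use p1.binomial_pure(3)[OF pure] p2.binomial_pure(3)[OF pure] p3.binomial_pure(3)[OF pure] min lt sums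
           in \<open>simp_all add: f_def\<close>)
    qed
  next
    case False
    then obtain l m where lm: "m \<noteq> l" "\<not> \<epsilon> l !! m < 0" by blast
    with critD(3)[OF \<epsilon>[of l], of m] have zero: "\<epsilon> l !! m = 0" by simp
    obtain n where n: "n \<noteq> l" "n \<noteq> m"
      using third_index[OF lm(1)] by metis
    interpret lmn: indexed_lattice L d l m n
      using lm n by (intro indexed) auto
    \<comment> \<open>The variables of \<open>\<delta>\<close> and \<open>- \<delta>\<close> receive
      the numbers 1 and 3, the remaining one the number 2.\<close>
    obtain i k \<delta> where ik: "i \<noteq> k" and \<delta>: "crit i \<delta>" "crit k (- \<delta>)"
      using lmn.opposite_critical_pair[OF \<epsilon> \<epsilon> \<epsilon> zero] by blast
    obtain j where j: "j \<noteq> i" "j \<noteq> k"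
      using third_index[OF ik] by metis
    interpret ijk: indexed_lattice L d i j k
      using ik j by (intro indexed) auto
    interpret jik: indexed_lattice L d j i k
      using ik j by (intro indexed) auto
    obtain \<beta> where \<beta>: "crit j \<beta>" "- \<beta> !! i \<le> \<delta> !! i" "\<beta> !! i < 0 \<or> \<beta> !! k < 0"
      using ijk.reduced_critical_vector[OF \<delta> \<epsilon>] .
    obtain \<pi> :: "3 \<Rightarrow> 3" where \<pi>: "bij \<pi>" "\<pi> 1 = i" "\<pi> 2 = j" "\<pi> 3 = k"
      using index_permutation[of i j k] ijk.ijk by metis
    \<comment> \<open>\<open>binom \<delta>\<close> is listed for \<open>i\<close> and, with
      opposite sign, for \<open>k\<close>, so that the full set has three members but needs only two
      generators.\<close>
    define f :: "3 \<Rightarrow> (3, 'k) mpol" where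
      "f x = (if x = i then binom \<delta> else if x = j then binom \<beta> else - binom \<delta>)" for x
    have f: "f i = binom \<delta>" "f j = binom \<beta>" "f k = - binom \<delta>"
      using ijk.ijk by (simp_all add: f_def)
    have range: "range f = {binom \<delta>, binom \<beta>, - binom \<delta>}"
      using ijk.all_indices f by (metis image_empty image_insert)
    have "\<forall>x. critical I x (f x)"
      unfolding ijk.all_index_iff f using critical \<delta> \<beta>(1) binom_uminus[of \<delta>] by metis
    then have full: "full_set_of_critical_binomials I f"
      by (simp add: full_set_of_critical_binomials_def)
    have two: "gideal {binom \<delta>, binom \<beta>} = I"
      unfolding I using \<delta> \<beta>(1) by (rule ijk.gideal_two_binomials)
    have gen: "gideal (range f) = I"
      unfolding range two[symmetric]
      by (intro antisym gideal_subset_gideal gideal_mono) (auto intro: gideal_base gideal_uminus)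
    have min: "minimally_generated mpol_ring I {f i, f j}"
      unfolding f I using \<delta> \<beta>(1) by (rule ijk.minimally_generated_two)
    have \<delta>j: "\<delta> !! j = 0"
      using critD(3)[OF \<delta>(1), of j] critD(3)[OF \<delta>(2), of j] j by simp
    have pure: "pure i \<delta>" "pure j \<beta>" "0 < \<delta> !! i" "\<delta> !! k < 0" "0 < \<beta> !! j"
      using \<delta> \<beta>(1) critD(2)[OF \<delta>(1)] critD(2)[OF \<delta>(2)] critD(2)[OF \<beta>(1)] by (auto simp: crit_def)
    show ?thesis
      by (rule exI[of _ f], intro conjI, rule full, rule gen[symmetric],
          rule exI[of _ \<pi>], intro conjI disjI1, rule \<pi>(1),
          unfold \<pi>(2-4),
          rule exI[of _ "nat (\<delta> !! i)"],
          rule exI[of _ "nat (- \<beta> !! i)"],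
          rule exI[of _ "nat (\<beta> !! j)"],
          rule exI[of _ "nat (- \<beta> !! k)"],
          rule exI[of _ "nat (- \<delta> !! k)"], intro conjI)
         (use ijk.binomial_pure(3)[OF pure(1)] jik.binomial_pure(3)[OF pure(2)] \<beta>(2,3) min \<delta>j pure(3-5)
          in \<open>auto simp: f\<close>)
  qed
qed

end
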